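(* Let $(\mathcal{F},\mathbf{O})$ be an acceptable pair and let $k\in\mathbb{N}$. A real function $\theta : D \to \mathbb{R}$, where $D \subseteq \mathbb{R}^k$, is conditionally $\mathbf{O}$-computable if and only if $\theta$ is conditionally $\mathcal{F}$-computable in the style of Tent and Ziegler.
   Context: $\mathbb{N}$ is the set of non-negative integers; $\mathcal{T}_m$ is the set of all total functions $\mathbb{N}^m\to\mathbb{N}$, and $\mathcal{T}=\bigcup_m \mathcal{T}_m$. For $s\in\mathbb{N}$, $\widehat{s}$ denotes the unary constant function $\lambda x.s$, and $\mathrm{id}_\mathbb{N}$ the identity on $\mathbb{N}$. An $n$-operator is a mapping $\mathcal{T}_1^n\to\mathcal{T}_1$. A function $g\in\mathcal{T}_m$ majorizes $f\in\mathcal{T}_m$ if $f(\vec x)\le g(\vec x)$ for all $\vec x$. The initial functions are all projections $\lambda x_1\ldots x_n.x_j$, the successor $\lambda x.x+1$, multiplication $\lambda xy.xy$, modified subtraction $\lambda xy.\max(x-y,0)$ and $\lambda xy.\lfloor x/(y+1)\rfloor$. Bounded minimization produces from $f\in\mathcal{T}_{k+1}$ the function $g(\vec x,y)$ equal to the least $z\le y$ with $f(\vec x,z)=0$ if such $z$ exists, and $y+1$ otherwise. A triple $(f,g,h)\in\mathcal{T}_1^3$ names a real number $\xi$ if $\left|\frac{f(n)-g(n)}{h(n)+1}-\xi\right|<\frac{1}{n+1}$ for all $n\in\mathbb{N}$. A pair $(\mathcal{F},\mathbf{O})$, with $\mathcal{F}\subseteq\mathcal{T}$ and $\mathbf{O}$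 a class of operators, is acceptable if: (1) the initial functions belong to $\mathcal{F}$; (2) $\mathcal{F}$ is closed under substitution and bounded minimization; (3) every $n$-operator $F\in\mathbf{O}$ is continuous: for all $f_1,\dots,f_n\in\mathcal{T}_1$ and $x$ there is $z$ such that $F(\vec g)(x)=F(\vec f)(x)$ whenever $g_i(t)=f_i(t)$ for all $t\le z$ and all $i$; (4) for each $n$, the $n$-operator $F(\vec f)(x)=x$ is in $\mathbf{O}$; (5) if the $n$-operator $F_0\in\mathbf{O}$ and $1\le j\le n$, then $F(\vec f)(x)=f_j(F_0(\vec f)(x))$ is in $\mathbf{O}$; (6) if $a\in\mathcal{T}_m\cap\mathcal{F}$ and $F_1,\dots,F_m$ are $n$-operators in $\mathbf{O}$, then $F(\vec f)(x)=a(F_1(\vec f)(x),\dots,F_m(\vec f)(x))$ is in $\mathbf{O}$; (7) if $F$ is a $k$-operator in $\mathbf{O}$ and $G_1,\dots,G_k$ are $n$-operators in $\mathbf{O}$, then $H(\vec f)=F(G_1(\vec f),\dots,G_k(\vec f))$ is in $\mathbf{O}$; (8) if $f_1,\dots,f_n\in\mathcal{T}_{m+1}\cap\mathcal{F}$ and $F$ is an $n$-operator in $\mathbf{O}$, then $a(\vec s,x)=F(\lambda t.f_1(\vec s,t),\dots,\lambda t.f_n(\vec s,t))(x)$ is in $\mathcal{F}$; (9) (uniformity) for every $n$-operator $F\in\mathbf{O}$ there is a $1$-operator $\Omega\in\mathbf{O}$ such that for all $x$ and every monotonically increasing $g\in\mathcal{T}_1$: if $f_1,\dots,f_n,f_1',\dots,f_n'\in\mathcal{T}_1$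 are all majorized by $g$ and $f_i(t)=f_i'(t)$ for all $i$ and all $t\le\Omega(g)(x)$, then $F(f_1,\dots,f_n)(x)=F(f_1',\dots,f_n')(x)$. $\theta:D\to\mathbb{R}$, $D\subseteq\mathbb{R}^k$, is conditionally $\mathbf{O}$-computable if there exist a $3k$-operator $E$ and $(3k+1)$-operators $F,G,H$, all in $\mathbf{O}$, such that whenever $(\xi_1,\dots,\xi_k)\in D$ and $(f_i,g_i,h_i)$ names $\xi_i$ for $i=1,\dots,k$: (i) there exists $s\in\mathbb{N}$ with $E(f_1,g_1,h_1,\dots,f_k,g_k,h_k)(s)=0$; and (ii) for every $s$ with this property, the triple $(F(f_1,g_1,h_1,\dots,f_k,g_k,h_k,\widehat{s}),\,G(\dots,\widehat{s}),\,H(\dots,\widehat{s}))$ (same arguments in all three) names $\theta(\xi_1,\dots,\xi_k)$. $\theta:D\to\mathbb{R}$, $D\subseteq\mathbb{R}^k$, is conditionally $\mathcal{F}$-computable in the style of Tent and Ziegler if there exist $d_0\in\mathcal{T}_1\cap\mathcal{F}$, $d\in\mathcal{T}_2\cap\mathcal{F}$, $e\in\mathcal{T}_{3k+1}\cap\mathcal{F}$ and $f,g,h\in\mathcal{T}_{6k+2}\cap\mathcal{F}$ such that for all $(\xi_1,\dots,\xi_k)\in D$: (A) there is $s_0\in\mathbb{N}$ such that for all $s\ge s_0$ and all $p_i^0,q_i^0,r_i^0\in\mathbb{N}$ ($i=1,\dots,k$), if $\left|\frac{p_i^0-q_i^0}{r_i^0+1}-\xi_i\right|<\frac{1}{d_0(s)+1}$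 for all $i$, then $e(p_1^0,q_1^0,r_1^0,\dots,p_k^0,q_k^0,r_k^0,s)=0$; (B) for all natural numbers $s,t$, $p_i^0,q_i^0,r_i^0,p_i,q_i,r_i$ ($i=1,\dots,k$) such that $\left|\frac{p_i^0-q_i^0}{r_i^0+1}-\xi_i\right|<\frac{1}{d_0(s)+1}$ for all $i$, $e(p_1^0,q_1^0,r_1^0,\dots,p_k^0,q_k^0,r_k^0,s)=0$, and $|\xi_i|\le s+1$ and $\left|\frac{p_i-q_i}{r_i+1}-\xi_i\right|<\frac{1}{d(s,t)+1}$ for all $i$, we have $\left|\frac{p-q}{r+1}-\theta(\xi_1,\dots,\xi_k)\right|<\frac{1}{t+1}$, where $p,q,r$ are the values of $f,g,h$ respectively at the argument $(p_1^0,q_1^0,r_1^0,\dots,p_k^0,q_k^0,r_k^0,p_1,q_1,r_1,\dots,p_k,q_k,r_k,s,t)$. *)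

theory Defs
  imports Complex_Main "HOL-Library.FuncSet"
begin

section \<open>Total functions and operators of a given arity\<close>

text \<open>The Cartesian power of a type is represented by the lists of a given length.\<close>

definition tuples :: "nat \<Rightarrow> 'a list set"
  where "tuples n = {v. length v = n}"

text \<open>Functions on tuples are taken extensional (value \<open>undefined\<close> on lists of any
  other length), so that the elements of \<open>total_funs m\<close> correspond one-to-one to the functions
  from \<open>\<nat>\<^sup>m\<close> to \<open>\<nat>\<close>, and those of \<open>operators n\<close> to the \<open>n\<close>-operators. An argument or value of
  an operator is a unary function and simply has the type \<open>nat \<Rightarrow> nat\<close>. The arities
  \<open>m = 0\<close> and \<open>n = 0\<close> are allowed.\<close>

definition total_funs :: "nat \<Rightarrow> (nat list \<Rightarrow> nat) set"
  where "total_funs m = tuples m \<rightarrow>\<^sub>E UNIV"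

type_synonym op_on_funs = "(nat \<Rightarrow> nat) list \<Rightarrow> nat \<Rightarrow> nat"

definition operators :: "nat \<Rightarrow> op_on_funs set"
  where "operators n = tuples n \<rightarrow>\<^sub>E UNIV"

definition majorizes :: "(nat \<Rightarrow> nat) \<Rightarrow> (nat \<Rightarrow> nat) \<Rightarrow> bool"
  where "majorizes g f \<longleftrightarrow> (\<forall>x. f x \<le> g x)"

definition bounded_min :: "nat \<Rightarrow> (nat list \<Rightarrow> nat) \<Rightarrow> nat list \<Rightarrow> nat"
  where "bounded_min k f = (\<lambda>v\<in>tuples (k + 1).
    let xs = butlast v; y = last v
    in if \<exists>z\<le>y. f (xs @ [z]) = 0 then (LEAST z. z \<le> y \<and> f (xs @ [z]) = 0) else y + 1)"


section \<open>Acceptable pairs\<close>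

text \<open>A class of functions of various arities is given by the family of its parts of fixed
  arity: \<open>\<F> m\<close> is the set of the \<open>m\<close>-ary functions in the class, and \<open>\<O> n\<close> is the set of
  the \<open>n\<close>-operators in the class of operators. Indices of tuple components start at 0.\<close>

locale acceptable_pair =
  fixes \<F> :: "nat \<Rightarrow> (nat list \<Rightarrow> nat) set"
    and \<O> :: "nat \<Rightarrow> op_on_funs set"
  assumes funs: "\<And>m. \<F> m \<subseteq> total_funs m"
    and ops: "\<And>n. \<O> n \<subseteq> operators n"
    and projection: "\<And>n j. j < n \<Longrightarrow> (\<lambda>v\<in>tuples n. v ! j) \<in> \<F> n"
    and successor: "(\<lambda>v\<in>tuples 1. v ! 0 + 1) \<in> \<F> 1"
    and multiplication: "(\<lambda>v\<in>tuples 2. v ! 0 * v ! 1) \<in> \<F> 2"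
    and modified_subtraction: "(\<lambda>v\<in>tuples 2. v ! 0 - v ! 1) \<in> \<F> 2"
    and quotient: "(\<lambda>v\<in>tuples 2. v ! 0 div (v ! 1 + 1)) \<in> \<F> 2"
    and substitution: "\<And>m n f gs. f \<in> \<F> m \<Longrightarrow> gs \<in> tuples m \<Longrightarrow> set gs \<subseteq> \<F> n \<Longrightarrow>
      (\<lambda>v\<in>tuples n. f (map (\<lambda>g. g v) gs)) \<in> \<F> n"
    and bounded_minimization: "\<And>k f. f \<in> \<F> (k + 1) \<Longrightarrow> bounded_min k f \<in> \<F> (k + 1)"
    and continuity: "\<And>n F fs x. F \<in> \<O> n \<Longrightarrow> fs \<in> tuples n \<Longrightarrow>
      \<exists>z. \<forall>gs\<in>tuples n. (\<forall>i<n. \<forall>t\<le>z. (gs ! i) t = (fs ! i) t) \<longrightarrow> F gs x = F fs x"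
    and identity_op: "\<And>n. (\<lambda>fs\<in>tuples n. \<lambda>x. x) \<in> \<O> n"
    and apply_argument_op: "\<And>n F j. F \<in> \<O> n \<Longrightarrow> j < n \<Longrightarrow>
      (\<lambda>fs\<in>tuples n. \<lambda>x. (fs ! j) (F fs x)) \<in> \<O> n"
    and apply_function_op: "\<And>m n a Fs. a \<in> \<F> m \<Longrightarrow> Fs \<in> tuples m \<Longrightarrow> set Fs \<subseteq> \<O> n \<Longrightarrow>
      (\<lambda>fs\<in>tuples n. \<lambda>x. a (map (\<lambda>F. F fs x) Fs)) \<in> \<O> n"
    and composition_op: "\<And>k n F Gs. F \<in> \<O> k \<Longrightarrow> Gs \<in> tuples k \<Longrightarrow> set Gs \<subseteq> \<O> n \<Longrightarrow>
      (\<lambda>fs\<in>tuples n. F (map (\<lambda>G. G fs) Gs)) \<in> \<O> n"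
    and apply_op_to_functions: "\<And>m n F fs. F \<in> \<O> n \<Longrightarrow> fs \<in> tuples n \<Longrightarrow> set fs \<subseteq> \<F> (m + 1) \<Longrightarrow>
      (\<lambda>v\<in>tuples (m + 1). F (map (\<lambda>f t. f (butlast v @ [t])) fs) (last v)) \<in> \<F> (m + 1)"
    and uniformity: "\<And>n F. F \<in> \<O> n \<Longrightarrow>
      \<exists>\<Omega>\<in>\<O> 1. \<forall>x g. mono g \<longrightarrow> (\<forall>fs\<in>tuples n. \<forall>fs'\<in>tuples n.
        (\<forall>i<n. majorizes g (fs ! i) \<and> majorizes g (fs' ! i)) \<and>
        (\<forall>i<n. \<forall>t\<le>\<Omega> [g] x. (fs ! i) t = (fs' ! i) t) \<longrightarrow> F fs x = F fs' x)"


section \<open>Computability of real functions\<close>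

fun triple_value :: "nat \<times> nat \<times> nat \<Rightarrow> real"
  where "triple_value (p, q, r) = (real p - real q) / (real r + 1)"

fun names :: "(nat \<Rightarrow> nat) \<times> (nat \<Rightarrow> nat) \<times> (nat \<Rightarrow> nat) \<Rightarrow> real \<Rightarrow> bool"
  where "names (f, g, h) \<xi> \<longleftrightarrow>
    (\<forall>n. \<bar>triple_value (f n, g n, h n) - \<xi>\<bar> < 1 / (real n + 1))"

definition flat :: "('a \<times> 'a \<times> 'a) list \<Rightarrow> 'a list"
  where "flat ts = concat (map (\<lambda>(a, b, c). [a, b, c]) ts)"

text \<open>In the next two definitions \<open>\<theta>\<close> is a function from \<open>D\<close> to the reals, where
  \<open>D \<subseteq> tuples k\<close>; its values outside \<open>D\<close> are irrelevant. Note that \<^const>\<open>list_all2\<close>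
  forces both lists to have the same length, here \<open>k\<close>.\<close>

definition conditionally_operator_computable ::
    "(nat \<Rightarrow> op_on_funs set) \<Rightarrow> nat \<Rightarrow> real list set \<Rightarrow> (real list \<Rightarrow> real) \<Rightarrow> bool"
  where "conditionally_operator_computable \<O> k D \<theta> \<longleftrightarrow>
    (\<exists>E\<in>\<O> (3 * k). \<exists>F\<in>\<O> (3 * k + 1). \<exists>G\<in>\<O> (3 * k + 1). \<exists>H\<in>\<O> (3 * k + 1).
      \<forall>\<xi>\<in>D. \<forall>ts. list_all2 names ts \<xi> \<longrightarrow>
        (\<exists>s. E (flat ts) s = 0) \<and>
        (\<forall>s. E (flat ts) s = 0 \<longrightarrow>
          names (F (flat ts @ [\<lambda>x. s]), G (flat ts @ [\<lambda>x. s]), H (flat ts @ [\<lambda>x. s])) (\<theta> \<xi>)))"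

definition approximates :: "nat \<Rightarrow> (nat \<times> nat \<times> nat) list \<Rightarrow> real list \<Rightarrow> bool"
  where "approximates n ps \<xi> \<longleftrightarrow>
    list_all2 (\<lambda>a x. \<bar>triple_value a - x\<bar> < 1 / (real n + 1)) ps \<xi>"

definition conditionally_computable_TZ ::
    "(nat \<Rightarrow> (nat list \<Rightarrow> nat) set) \<Rightarrow> nat \<Rightarrow> real list set \<Rightarrow> (real list \<Rightarrow> real) \<Rightarrow> bool"
  where "conditionally_computable_TZ \<F> k D \<theta> \<longleftrightarrow>
    (\<exists>d0\<in>\<F> 1. \<exists>d\<in>\<F> 2. \<exists>e\<in>\<F> (3 * k + 1).
     \<exists>f\<in>\<F> (6 * k + 2). \<exists>g\<in>\<F> (6 * k + 2). \<exists>h\<in>\<F> (6 * k + 2).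
      \<forall>\<xi>\<in>D.
        (\<exists>s0. \<forall>s\<ge>s0. \<forall>ps0. approximates (d0 [s]) ps0 \<xi> \<longrightarrow> e (flat ps0 @ [s]) = 0) \<and>
        (\<forall>s t ps0 ps.
          approximates (d0 [s]) ps0 \<xi> \<and> e (flat ps0 @ [s]) = 0 \<and>
          (\<forall>x\<in>set \<xi>. \<bar>x\<bar> \<le> real s + 1) \<and> approximates (d [s, t]) ps \<xi> \<longrightarrow>
          (let v = flat ps0 @ flat ps @ [s, t]
           in \<bar>triple_value (f v, g v, h v) - \<theta> \<xi>\<bar> < 1 / (real t + 1))))"

end

theory Submission
  imports Defs
begin

text \<open>
  From Tent--Ziegler to operators, names are evaluated at the precisions \<open>d0 s\<close> and \<open>d(s, t)\<close>, and
  \<open>E\<close> also tests that \<open>s\<close> dominates the approximations at precision 0, so that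
  \<open>\<bar>\<xi>\<^sub>i\<bar> \<le> s + 1\<close>.

  Conversely, a single triple \<open>a\<close> that approximates \<open>\<xi>\<close> with error below \<open>1 / (2 N + 2)\<close> is turned into
  the functions \<open>t \<mapsto> rounding t a\<close>, which agree up to \<open>N\<close> with a genuine name of \<open>\<xi>\<close> and are
  majorized by \<open>majorant s\<close> as soon as \<open>\<bar>\<xi>\<bar> \<le> s + 1\<close>. Hence uniformity bounds the precision \<open>N\<close>
  at which the operators cannot tell them from a genuine name. The condition \<open>e = 0\<close> says that
  \<open>E\<close>, applied to the rounded coarse approximation, has a zero \<open>z \<le> s\<close>; the least such \<open>z\<close>
  is passed on to \<open>F\<close>, \<open>G\<close>, \<open>H\<close>. That \<open>e\<close> vanishes for all large \<open>s\<close>, uniformly in the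
  approximation, is a compactness argument: the majorized names of \<open>\<xi>\<close> are the branches of a
  finitely branching tree, and \<open>E\<close> is continuous.
\<close>

section \<open>Compactness of finitely branching trees\<close>

text \<open>This is Koenig's lemma: if no bound works for all branches, then some successor of each
  bad prefix is bad too, since otherwise the maximum of finitely many bounds would serve. The
  resulting infinite branch has a witness that depends only on a prefix, contradicting the badness
  of that prefix.\<close>

lemma bounded_witness_of_finite_branching:
  fixes A :: "nat \<Rightarrow> 'a set" and Q :: "(nat \<Rightarrow> 'a) \<Rightarrow> nat \<Rightarrow> bool"
  assumes fin: "\<And>t. finite (A t)"
    and ex: "\<And>\<phi>. \<forall>t. \<phi> t \<in> A t \<Longrightarrow> \<exists>z. Q \<phi> z"
    and local: "\<And>\<phi> z. Q \<phi> z \<Longrightarrow> \<exists>n. \<forall>\<psi>. (\<forall>t<n. \<psi> t = \<phi> t) \<longrightarrow> Q \<psi> z"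
  shows "\<exists>z0. \<forall>\<phi>. (\<forall>t. \<phi> t \<in> A t) \<longrightarrow> (\<exists>z\<le>z0. Q \<phi> z)"
proof (rule ccontr)
  assume neg: "\<not> ?thesis"
  \<comment> \<open>Only the values of \<open>u\<close> below \<open>n\<close> matter:
    \<open>u\<close> stands for a prefix of length \<open>n\<close> above which no single
    \<open>z0\<close> bounds the witnesses.\<close>
  define bad where "bad n u \<longleftrightarrow> (\<forall>z0. \<exists>\<phi>. (\<forall>t. \<phi> t \<in> A t) \<and> (\<forall>t<n. \<phi> t = u t) \<and>
    (\<forall>z\<le>z0. \<not> Q \<phi> z))" for n :: nat and u
  have step: "\<exists>u'. bad (Suc n) u' \<and> (\<forall>t<n. u' t = u t)" if "bad n u" for n u
  proof -
    have "\<exists>a\<in>A n. bad (Suc n) (u(n := a))"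
    proof (rule ccontr)
      assume "\<not> ?thesis"
      then have "\<forall>a\<in>A n. \<exists>z0. \<forall>\<phi>. (\<forall>t. \<phi> t \<in> A t) \<and> (\<forall>t<Suc n. \<phi> t = (u(n := a)) t) \<longrightarrow>
          (\<exists>z\<le>z0. Q \<phi> z)"
        unfolding bad_def by meson
      from bchoice[OF this] obtain b where b: "\<forall>a\<in>A n. \<forall>\<phi>. (\<forall>t. \<phi> t \<in> A t) \<and>
          (\<forall>t<Suc n. \<phi> t = (u(n := a)) t) \<longrightarrow> (\<exists>z\<le>b a. Q \<phi> z)" ..
      obtain \<phi> where \<phi>: "\<forall>t. \<phi> t \<in> A t" "\<forall>t<n. \<phi> t = u t" "\<forall>z\<le>Max (b ` A n). \<not> Q \<phi> z"
        using \<open>bad n u\<close> unfolding bad_def by blast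
      have "\<exists>z\<le>b (\<phi> n). Q \<phi> z"
        using \<phi> by (intro b[rule_format]) (auto simp: less_Suc_eq)
      moreover have "b (\<phi> n) \<le> Max (b ` A n)"
        using \<phi>(1) fin by simp
      ultimately show False
        using \<phi>(3) order_trans by blast
    qed
    then show ?thesis
      by (metis fun_upd_other less_irrefl)
  qed
  have "bad 0 u" for u
    using neg unfolding bad_def by auto
  then obtain U where U: "\<And>n. bad n (U n)" "\<And>n. \<forall>t<n. U (Suc n) t = U n t"
    using dependent_nat_choice[of bad "\<lambda>n u u'. \<forall>t<n. u' t = u t"] step by blast
  \<comment> \<open>The entry at \<open>n\<close> is settled in \<open>U (Suc n)\<close> and is
    preserved by all later prefixes.\<close>
  define \<psi> where "\<psi> n = U (Suc n) n" for n
  have \<psi>: "\<forall>t<n. U n t = \<psi> t" for n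
    by (induction n) (use U(2) in \<open>auto simp: \<psi>_def less_Suc_eq\<close>)
  have "\<psi> t \<in> A t" for t
    using U(1)[of "Suc t"] \<psi>[of "Suc t"] unfolding bad_def by (metis lessI)
  then obtain z where "Q \<psi> z"
    using ex by blast
  then obtain n where "\<forall>\<phi>. (\<forall>t<n. \<phi> t = \<psi> t) \<longrightarrow> Q \<phi> z"
    using local by blast
  then show False
    using U(1)[of n] \<psi>[of n] unfolding bad_def by (metis order_refl)
qed


section \<open>Lists of triples\<close>

text \<open>Every index from 2 on selects the third entry, so bounds on the entries of a triple can
  be stated for all \<open>j\<close>.\<close>

definition component :: "nat \<Rightarrow> 'a \<times> 'a \<times> 'a \<Rightarrow> 'a"
  where "component j = (\<lambda>(a, b, c). if j = 0 then a else if j = 1 then b else c)"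

lemma flat_Nil [simp]: "flat [] = []"
  by (simp add: flat_def)

lemma flat_Cons [simp]: "flat ((a, b, c) # ts) = a # b # c # flat ts"
  by (simp add: flat_def)

lemma length_flat [simp]: "length (flat ts) = 3 * length ts"
  by (induction ts) auto

lemma nth_flat:
  assumes "i < 3 * length ts"
  shows "flat ts ! i = component (i mod 3) (ts ! (i div 3))"
  using assms
proof (induction ts arbitrary: i)
  case (Cons t ts)
  obtain a b c where t: "t = (a, b, c)"
    by (cases t)
  consider "i = 0" | "i = 1" | "i = 2" | j where "i = j + 3"
    by (metis One_nat_def Suc_1 add.commute add_2_eq_Suc' less_Suc_eq less_nat_zero_code
        not_less le_Suc_ex numeral_3_eq_3)
  then show ?case
    using Cons.IH[of "i - 3"] Cons.prems
    by cases (auto simp: t component_def)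
qed simp

lemma triple_nth_flat:
  assumes "i < length ts"
  shows "(flat ts ! (3 * i), flat ts ! (3 * i + 1), flat ts ! (3 * i + 2)) = ts ! i"
proof -
  have "3 * i div 3 = i" "(3 * i + 1) div 3 = i" "(3 * i + 2) div 3 = i"
    "3 * i mod 3 = 0" "(3 * i + 1) mod 3 = 1" "(3 * i + 2) mod 3 = 2"
    by presburger+
  then show ?thesis
    using assms by (cases "ts ! i") (simp only: nth_flat, simp add: nth_flat component_def)
qed

lemma map_flat: "map g (flat ts) = flat (map (\<lambda>(a, b, c). (g a, g b, g c)) ts)"
  by (induction ts) auto

lemma flat_map_triple:
  assumes "length ts = k"
  shows "map (\<lambda>i. (flat ts ! i) x) [0..<3 * k] = flat (map (\<lambda>(a, b, c). (a x, b x, c x)) ts)"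
proof -
  have "map (\<lambda>i. (flat ts ! i) x) [0..<3 * k] = map (\<lambda>f. f x) (flat ts)"
    using assms by (intro nth_equalityI) auto
  then show ?thesis
    by (simp only: map_flat)
qed

text \<open>Compactness and rounding treat a name as a sequence of lists of triples indexed by the
  precision; operators expect the transposed object, a list of triples of functions.\<close>

definition unzip :: "nat \<Rightarrow> (nat \<Rightarrow> (nat \<times> nat \<times> nat) list) \<Rightarrow>
    ((nat \<Rightarrow> nat) \<times> (nat \<Rightarrow> nat) \<times> (nat \<Rightarrow> nat)) list"
  where "unzip k \<phi> = map (\<lambda>i. (\<lambda>t. component 0 (\<phi> t ! i), \<lambda>t. component 1 (\<phi> t ! i),
    \<lambda>t. component 2 (\<phi> t ! i))) [0..<k]"

lemma length_unzip [simp]: "length (unzip k \<phi>) = k"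
  by (simp add: unzip_def)

lemma nth_flat_unzip:
  assumes "i < 3 * k"
  shows "flat (unzip k \<phi>) ! i = (\<lambda>t. component (i mod 3) (\<phi> t ! (i div 3)))"
proof -
  have "i mod 3 = 0 \<or> i mod 3 = 1 \<or> i mod 3 = 2" "i div 3 < k"
    using assms by auto
  then show ?thesis
    using assms by (auto simp: nth_flat) (auto simp: unzip_def component_def)
qed

lemma names_unzip_iff:
  assumes "length \<xi> = k" "\<And>t. length (\<phi> t) = k"
  shows "list_all2 names (unzip k \<phi>) \<xi> \<longleftrightarrow> (\<forall>t. approximates t (\<phi> t) \<xi>)"
proof -
  have "triple_value (component 0 a, component (Suc 0) a, component 2 a) = triple_value a" for a
    by (cases a) (simp add: component_def)
  then show ?thesis
    using assms by (auto simp: list_all2_conv_all_nth approximates_def unzip_def)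
qed


section \<open>Rounding to names with a computable majorant\<close>

lemma approximates_mono:
  assumes "approximates n ps \<xi>" "m \<le> n"
  shows "approximates m ps \<xi>"
proof -
  have "1 / (real n + 1) \<le> 1 / (real m + 1)"
    using assms(2) by (simp add: frac_le)
  then show ?thesis
    using assms(1) unfolding approximates_def by (elim list_all2_mono) linarith
qed

lemma approximates_length: "approximates n ps \<xi> \<Longrightarrow> length ps = length \<xi>"
  unfolding approximates_def by (rule list_all2_lengthD)

lemma ex_triple_approximating: "\<exists>a. \<bar>triple_value a - x\<bar> < 1 / (real n + 1)"
proof -
  \<comment> \<open>The fraction \<open>m / (n + 1)\<close> is realized by the positive and negative
    parts of the integer \<open>m\<close>, because the entries of a triple are natural
    numbers.\<close>
  define m where "m = \<lfloor>x * (real n + 1)\<rfloor>"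
  have "real (nat m) - real (nat (- m)) = real_of_int m"
    by (cases "m \<ge> 0") auto
  then have "triple_value (nat m, nat (- m), n) = real_of_int m / (real n + 1)"
    by simp
  moreover have "\<bar>real_of_int m - x * (real n + 1)\<bar> < 1"
    unfolding m_def by linarith
  then have "\<bar>real_of_int m / (real n + 1) - x\<bar> < 1 / (real n + 1)"
  proof -
    have "real_of_int m / (real n + 1) - x = (real_of_int m - x * (real n + 1)) / (real n + 1)"
      by (simp add: field_simps)
    then show ?thesis
      using \<open>\<bar>real_of_int m - x * (real n + 1)\<bar> < 1\<close>
      by (simp add: abs_divide divide_strict_right_mono)
  qed
  ultimately show ?thesis
    by metis
qed

lemma ex_approximates: "\<exists>ps. approximates n ps \<xi>"
proof (induction \<xi>)
  case (Cons x \<xi>)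
  then show ?case
    using ex_triple_approximating[of x n] unfolding approximates_def by (metis list_all2_Cons)
qed (auto simp: approximates_def)

text \<open>The denominators do not depend on the given triple, which yields a bound on all components.\<close>

definition rounding :: "nat \<Rightarrow> nat \<times> nat \<times> nat \<Rightarrow> nat \<times> nat \<times> nat"
  where "rounding t = (\<lambda>(p, q, r).
    ((p - q) * (2 * (t + 1)) div (r + 1), (q - p) * (2 * (t + 1)) div (r + 1), 2 * t + 1))"

text \<open>If \<open>\<bar>\<xi>\<bar> \<le> s + 1\<close>, then an approximation with error below
  1 is at most \<open>s + 2\<close> in absolute value; multiplying by the denominator
  \<open>2 * (t + 1)\<close> used in rounding bounds the numerators. The value also dominates
  \<open>s\<close>, hence any constant argument up to \<open>s\<close>.\<close>

definition majorant :: "nat \<Rightarrow> nat \<Rightarrow> nat"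
  where "majorant s t = (s + 2) * (2 * (t + 1))"

lemma mono_majorant: "mono (majorant s)"
  unfolding majorant_def by (intro monoI mult_le_mono) auto

lemma le_majorant: "s \<le> majorant s t"
  unfolding majorant_def by simp

lemma real_div_bounds:
  fixes a b :: nat
  shows "real (a div (b + 1)) \<le> real a / (real b + 1)"
    and "real a / (real b + 1) < real (a div (b + 1)) + 1"
proof -
  have "real (a div (b + 1)) = real_of_int \<lfloor>real a / (real b + 1)\<rfloor>"
    using floor_divide_of_nat_eq[of a "b + 1", where ?'a = real]
    by (metis of_int_of_nat_eq of_nat_1 of_nat_add)
  then show "real (a div (b + 1)) \<le> real a / (real b + 1)"
    and "real a / (real b + 1) < real (a div (b + 1)) + 1"
    by linarith+
qed

text \<open>At least one of the truncated differences \<open>p - q\<close> and \<open>q - p\<close>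
  vanishes, so only one floor contributes an error, and that error is less than one unit
  \<open>1 / M\<close>.\<close>

lemma triple_value_rounding:
  "\<bar>triple_value (rounding t a) - triple_value a\<bar> < 1 / (2 * (real t + 1))"
proof -
  obtain p q r where a: "a = (p, q, r)"
    by (cases a)
  define M where "M = 2 * (t + 1)"
  define P where "P = real ((p - q) * M div (r + 1)) - real ((p - q) * M) / (real r + 1)"
  define Q where "Q = real ((q - p) * M div (r + 1)) - real ((q - p) * M) / (real r + 1)"
  have PQ: "\<bar>P\<bar> < 1" "\<bar>Q\<bar> < 1" "P = 0 \<or> Q = 0"
    using real_div_bounds[of "(p - q) * M" r] real_div_bounds[of "(q - p) * M" r]
    unfolding P_def Q_def by auto
  have pq: "real p - real q = real (p - q) - real (q - p)"
    by (cases "p \<le> q") auto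
  have "triple_value (rounding t a) = (real ((p - q) * M div (r + 1)) - real ((q - p) * M div (r + 1))) / M"
    unfolding a rounding_def M_def by (simp add: algebra_simps)
  moreover have "triple_value a = (real ((p - q) * M) / (real r + 1) - real ((q - p) * M) / (real r + 1)) / M"
    unfolding a triple_value.simps pq M_def
    by (simp add: divide_simps) (simp add: algebra_simps)
  ultimately have "triple_value (rounding t a) - triple_value a = (P - Q) / M"
    unfolding P_def Q_def by (simp add: diff_divide_distrib)
  moreover have "\<bar>P - Q\<bar> < 1"
    using PQ by auto
  ultimately show ?thesis
    unfolding M_def by (simp add: abs_divide divide_strict_right_mono algebra_simps)
qed

lemma component_rounding_le:
  assumes "\<bar>triple_value a\<bar> \<le> real s + 2"
  shows "component j (rounding t a) \<le> majorant s t"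
proof -
  obtain p q r where a: "a = (p, q, r)"
    by (cases a)
  have *: "b * (2 * (t + 1)) div (r + 1) \<le> majorant s t" if "real b / (real r + 1) \<le> real s + 2" for b
  proof -
    have "real (b * (2 * (t + 1)) div (r + 1)) \<le> real b / (real r + 1) * (2 * (real t + 1))"
      using real_div_bounds(1)[of "b * (2 * (t + 1))" r]
      by (simp only: of_nat_mult of_nat_add of_nat_numeral of_nat_1 times_divide_eq_left)
    also have "\<dots> \<le> (real s + 2) * (2 * (real t + 1))"
      using that by (intro mult_right_mono) auto
    also have "\<dots> = real (majorant s t)"
      by (simp add: majorant_def algebra_simps)
    finally show ?thesis
      by simp
  qed
  have "real (p - q) / (real r + 1) \<le> real s + 2 \<and> real (q - p) / (real r + 1) \<le> real s + 2"
    using assms unfolding a by (cases "p \<le> q") (auto simp: field_simps abs_le_iff)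
  moreover have "2 * t + 1 \<le> majorant s t"
    by (simp add: majorant_def)
  ultimately show ?thesis
    using * unfolding a rounding_def component_def by auto
qed

text \<open>Half of the permitted error \<open>1 / (t + 1)\<close> is spent on the input and half on
  rounding; this is where the precisions \<open>2 * t + 1\<close> below come from.\<close>

lemma approximates_rounding:
  assumes "approximates (2 * t + 1) ps \<xi>"
  shows "approximates t (map (rounding t) ps) \<xi>"
proof -
  have "\<bar>triple_value (rounding t a) - x\<bar> < 1 / (real t + 1)"
    if "\<bar>triple_value a - x\<bar> < 1 / (real (2 * t + 1) + 1)" for a x
  proof -
    have "1 / (real (2 * t + 1) + 1) + 1 / (2 * (real t + 1)) = 1 / (real t + 1)"
      by (simp add: field_simps)
    then show ?thesis
      using that triple_value_rounding[of t a] by argo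
  qed
  then show ?thesis
    using assms unfolding approximates_def list_all2_map1 by (rule list_all2_mono[rotated])
qed

text \<open>At every precision \<open>n\<close> the error is below 1, so coarse and fine
  approximations share the same majorant.\<close>

lemma approximates_rounding_le:
  assumes "approximates n ps \<xi>" "\<forall>x\<in>set \<xi>. \<bar>x\<bar> \<le> real s + 1" "i < length \<xi>"
  shows "component j (rounding t (ps ! i)) \<le> majorant s t"
proof (rule component_rounding_le)
  have "\<bar>triple_value (ps ! i) - \<xi> ! i\<bar> < 1"
    using approximates_mono[OF assms(1), of 0] assms(3)
    by (auto simp: approximates_def list_all2_conv_all_nth)
  moreover have "\<bar>\<xi> ! i\<bar> \<le> real s + 1"
    using assms by simp
  ultimately show "\<bar>triple_value (ps ! i)\<bar> \<le> real s + 2"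
    by linarith
qed

text \<open>The list being rounded may vary with the precision \<open>t\<close>. A constant
  \<open>\<phi>\<close> gives functions computable from one list of triples, while a sufficiently
  precise \<open>\<phi>\<close> gives a genuine name.\<close>

definition rounded_funs :: "nat \<Rightarrow> (nat \<Rightarrow> (nat \<times> nat \<times> nat) list) \<Rightarrow> (nat \<Rightarrow> nat) list"
  where "rounded_funs k \<phi> = flat (unzip k (\<lambda>t. map (rounding t) (\<phi> t)))"

lemma length_rounded_funs [simp]: "length (rounded_funs k \<phi>) = 3 * k"
  by (simp add: rounded_funs_def)

lemma nth_rounded_funs:
  assumes "i < 3 * k" "\<And>t. length (\<phi> t) = k"
  shows "rounded_funs k \<phi> ! i = (\<lambda>t. component (i mod 3) (rounding t (\<phi> t ! (i div 3))))"
proof -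
  have "i div 3 < k"
    using assms(1) by auto
  then show ?thesis
    using assms by (simp add: rounded_funs_def nth_flat_unzip)
qed

lemma majorizes_rounded_funs:
  assumes "\<And>t. approximates (n t) (\<phi> t) \<xi>" "\<forall>x\<in>set \<xi>. \<bar>x\<bar> \<le> real s + 1"
    "length \<xi> = k" "i < 3 * k"
  shows "majorizes (majorant s) (rounded_funs k \<phi> ! i)"
proof -
  have "i div 3 < length \<xi>" "\<And>t. length (\<phi> t) = k"
    using assms(3,4) approximates_length[OF assms(1)] by auto
  then show ?thesis
    using approximates_rounding_le[OF assms(1,2)] assms(3,4)
    by (simp add: nth_rounded_funs majorizes_def)
qed

lemma ex_bound_abs: "\<exists>s::nat. \<forall>x\<in>set \<xi>. \<bar>x\<bar> \<le> real s + 1"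
proof (induction \<xi>)
  case (Cons x \<xi>)
  then obtain s :: nat where s: "\<forall>x\<in>set \<xi>. \<bar>x\<bar> \<le> real s + 1"
    by blast
  obtain s' :: nat where "\<bar>x\<bar> \<le> real s'"
    using real_arch_simple by blast
  with s have "\<forall>y\<in>set (x # \<xi>). \<bar>y\<bar> \<le> real (s + s') + 1"
    by force
  then show ?case
    by blast
qed simp


lemma names_imp_approximates:
  assumes "list_all2 names ts \<xi>"
  shows "approximates n (map (\<lambda>(a, b, c). (a n, b n, c n)) ts) \<xi>"
  using assms unfolding approximates_def list_all2_map1
  by (rule list_all2_mono) (auto simp del: triple_value.simps)

text \<open>A name evaluated at 0 has error below 1, and its quotient is at most its larger
  numerator entry in absolute value. The bound on \<open>\<bar>x\<bar>\<close> thus follows from a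
  test on finitely many numbers, which an operator can perform.\<close>

lemma names_imp_bound_abs:
  assumes "list_all2 names ts \<xi>" "\<And>i. i < 3 * length ts \<Longrightarrow> (flat ts ! i) 0 \<le> s" "x \<in> set \<xi>"
  shows "\<bar>x\<bar> \<le> real s + 1"
proof -
  obtain j where j: "j < length ts" "names (ts ! j) x"
    using assms(1,3) by (auto simp: list_all2_conv_all_nth in_set_conv_nth)
  obtain a b c where abc: "ts ! j = (a, b, c)"
    by (cases "ts ! j")
  have "(a, b) = (flat ts ! (3 * j), flat ts ! (3 * j + 1))"
    using triple_nth_flat[OF j(1)] by (simp add: abc)
  then have "a 0 \<le> s" "b 0 \<le> s"
    using assms(2)[of "3 * j"] assms(2)[of "3 * j + 1"] j(1) by simp_all
  then have "\<bar>real (a 0) - real (b 0)\<bar> \<le> real s"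
    by linarith
  also have "\<dots> \<le> real s * (real (c 0) + 1)"
    by (simp add: algebra_simps)
  finally have "\<bar>(real (a 0) - real (b 0)) / (real (c 0) + 1)\<bar> \<le> real s"
    by (simp add: pos_divide_le_eq)
  moreover have "\<bar>(real (a 0) - real (b 0)) / (real (c 0) + 1) - x\<bar> < 1"
    using j(2) by (auto simp: abc dest!: spec[of _ 0])
  ultimately show ?thesis
    by linarith
qed

lemma rounded_funs_cong:
  assumes "\<phi> t = \<psi> t" "i < 3 * k"
  shows "(rounded_funs k \<phi> ! i) t = (rounded_funs k \<psi> ! i) t"
  using assms by (simp add: rounded_funs_def nth_flat_unzip)

text \<open>The lists \<open>\<phi> t\<close> precise enough for rounding at \<open>t\<close> are
  kept, and the others are replaced by arbitrarily chosen good ones. The choice need not be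
  computable, since \<open>\<psi>\<close> only serves as an object of comparison.\<close>

lemma ex_names_extending:
  assumes "\<And>t. approximates (n t) (\<phi> t) \<xi>" "length \<xi> = k"
  shows "\<exists>\<psi>. list_all2 names (unzip k (\<lambda>t. map (rounding t) (\<psi> t))) \<xi> \<and>
    (\<forall>t. approximates (2 * t + 1) (\<psi> t) \<xi>) \<and> (\<forall>t. 2 * t + 1 \<le> n t \<longrightarrow> \<psi> t = \<phi> t)"
proof -
  define \<beta> where "\<beta> n = (SOME ps. approximates n ps \<xi>)" for n
  have \<beta>: "approximates n (\<beta> n) \<xi>" for n
    unfolding \<beta>_def by (rule someI_ex) (rule ex_approximates)
  define \<psi> where "\<psi> t = (if 2 * t + 1 \<le> n t then \<phi> t else \<beta> (2 * t + 1))" for t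
  have \<psi>: "approximates (2 * t + 1) (\<psi> t) \<xi>" for t
    using approximates_mono[OF assms(1)] \<beta> by (simp add: \<psi>_def)
  then have "list_all2 names (unzip k (\<lambda>t. map (rounding t) (\<psi> t))) \<xi>"
    using approximates_length[OF \<psi>] assms(2) approximates_rounding[OF \<psi>] by (subst names_unzip_iff) auto
  moreover have "\<forall>t. 2 * t + 1 \<le> n t \<longrightarrow> \<psi> t = \<phi> t"
    by (simp add: \<psi>_def)
  ultimately show ?thesis
    using \<psi> by blast
qed

lemma finite_bounded_triple_lists:
  "finite {as :: (nat \<times> nat \<times> nat) list. length as = k \<and> (\<forall>i<k. \<forall>j. component j (as ! i) \<le> M)}"
proof (rule finite_subset)
  let ?B = "{..M} \<times> {..M} \<times> {..M}"
  show "finite {as. set as \<subseteq> ?B \<and> length as = k}"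
    by (intro finite_lists_length_eq finite_cartesian_product) auto
  have *: "a \<in> ?B" if "\<forall>j. component j a \<le> M" for a
    using that[rule_format, of 0] that[rule_format, of 1] that[rule_format, of 2]
    by (cases a) (simp add: component_def)
  then show "{as. length as = k \<and> (\<forall>i<k. \<forall>j. component j (as ! i) \<le> M)} \<subseteq> {as. set as \<subseteq> ?B \<and> length as = k}"
    by (intro Collect_mono impI conjI subsetI) (metis * in_set_conv_nth, blast)
qed


section \<open>Definability in an acceptable pair\<close>

context acceptable_pair
begin

text \<open>Membership in \<open>\<F>\<close> and \<open>\<O>\<close> up to the values at lists of the wrong length.\<close>

definition definable :: "nat \<Rightarrow> (nat list \<Rightarrow> nat) \<Rightarrow> bool"
  where "definable n f \<longleftrightarrow> restrict f (tuples n) \<in> \<F> n"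

lemma definable_of_mem:
  assumes "f \<in> \<F> n"
  shows "definable n f"
proof -
  have "restrict f (tuples n) = f"
    using subsetD[OF funs assms] unfolding total_funs_def by (rule PiE_restrict)
  then show ?thesis
    using assms by (simp add: definable_def)
qed

lemma definable_cong:
  assumes "\<And>v. length v = n \<Longrightarrow> f v = g v"
  shows "definable n f \<longleftrightarrow> definable n g"
proof -
  have "restrict f (tuples n) = restrict g (tuples n)"
    using assms by (auto simp: tuples_def)
  then show ?thesis
    by (simp add: definable_def)
qed

section \<open>Arithmetic and bounded search in the class of functions\<close>

lemma definable_nth: "j < n \<Longrightarrow> definable n (\<lambda>v. v ! j)"
  using projection by (simp add: definable_def)

lemma definable_subst:
  assumes "definable m f" "\<And>i. i < m \<Longrightarrow> definable n (g i)"
  shows "definable n (\<lambda>v. f (map (\<lambda>i. g i v) [0..<m]))"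
proof -
  let ?gs = "map (\<lambda>i. restrict (g i) (tuples n)) [0..<m]"
  have "(\<lambda>v\<in>tuples n. restrict f (tuples m) (map (\<lambda>g. g v) ?gs)) \<in> \<F> n"
    using assms unfolding definable_def by (intro substitution) (auto simp: tuples_def[of m] simp del: restrict_apply)
  also have "(\<lambda>v\<in>tuples n. restrict f (tuples m) (map (\<lambda>g. g v) ?gs)) =
      (\<lambda>v\<in>tuples n. f (map (\<lambda>i. g i v) [0..<m]))"
    by (rule restrict_ext) (simp add: tuples_def comp_def)
  finally show ?thesis
    unfolding definable_def .
qed

lemma definable_subst1:
  assumes "definable 1 f" "definable n a"
  shows "definable n (\<lambda>v. f [a v])"
  using definable_subst[OF assms(1), of n "\<lambda>_. a"] assms(2) by simp

lemma definable_subst2: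
  assumes "definable 2 f" "definable n a" "definable n b"
  shows "definable n (\<lambda>v. f [a v, b v])"
  using definable_subst[OF assms(1), of n "\<lambda>i. if i = 0 then a else b"] assms(2,3)
  by (simp add: upt_rec)

lemma definable_subst_append:
  assumes "definable (m + l) f" "\<And>i. i < m \<Longrightarrow> definable n (a i)" "\<And>i. i < l \<Longrightarrow> definable n (b i)"
  shows "definable n (\<lambda>v. f (map (\<lambda>i. a i v) [0..<m] @ map (\<lambda>i. b i v) [0..<l]))"
proof -
  let ?c = "\<lambda>i. if i < m then a i else b (i - m)"
  have "map (\<lambda>i. ?c i v) [0..<m + l] = map (\<lambda>i. a i v) [0..<m] @ map (\<lambda>i. b i v) [0..<l]" for v
    by (rule nth_equalityI) (auto simp: nth_append)
  then show ?thesis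
    using definable_subst[OF assms(1), of n ?c] assms(2,3) by simp
qed

lemma definable_Suc: "definable n a \<Longrightarrow> definable n (\<lambda>v. Suc (a v))"
  using definable_subst1[of "\<lambda>v. v ! 0 + 1"] successor by (simp add: definable_def)

lemma definable_mult: "definable n a \<Longrightarrow> definable n b \<Longrightarrow> definable n (\<lambda>v. a v * b v)"
  using definable_subst2[of "\<lambda>v. v ! 0 * v ! 1"] multiplication by (simp add: definable_def)

lemma definable_diff: "definable n a \<Longrightarrow> definable n b \<Longrightarrow> definable n (\<lambda>v. a v - b v)"
  using definable_subst2[of "\<lambda>v. v ! 0 - v ! 1"] modified_subtraction by (simp add: definable_def)

lemma definable_div: "definable n a \<Longrightarrow> definable n b \<Longrightarrow> definable n (\<lambda>v. a v div (b v + 1))"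
  using definable_subst2[of "\<lambda>v. v ! 0 div (v ! 1 + 1)"] quotient by (simp add: definable_def)

text \<open>Zero arises as \<open>x - x\<close> for the first variable \<open>x\<close>, which is
  available because \<open>n > 0\<close>.\<close>

lemma definable_const:
  assumes "n > 0"
  shows "definable n (\<lambda>_. c)"
proof (induction c)
  case 0
  then show ?case
    using definable_diff[OF definable_nth definable_nth, OF assms assms] by simp
qed (rule definable_Suc)

text \<open>Addition is not an initial function: \<open>x + y = (x + 1) (y + 1) - x y - 1\<close>.\<close>

lemma definable_add:
  assumes "definable n a" "definable n b"
  shows "definable n (\<lambda>v. a v + b v)"
proof -
  have "definable n (\<lambda>v. Suc (a v) * Suc (b v) - Suc (a v * b v))"
    using assms by (intro definable_diff definable_mult definable_Suc)
  then show ?thesis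
    by (simp add: add.commute)
qed

text \<open>With truncated subtraction, \<open>1 - (a - b)\<close> is the characteristic function of
  \<open>a \<le> b\<close>, and subtracting it from 1 gives that of the complement.\<close>

lemma definable_if_le:
  assumes "definable n a" "definable n b" "definable n c" "definable n d" "n > 0"
  shows "definable n (\<lambda>v. if a v \<le> b v then c v else d v)"
proof -
  have "definable n (\<lambda>v. (1 - (a v - b v)) * c v + (1 - (1 - (a v - b v))) * d v)"
    using assms by (intro definable_add definable_mult definable_diff definable_const)
  also have "(\<lambda>v. (1 - (a v - b v)) * c v + (1 - (1 - (a v - b v))) * d v) =
      (\<lambda>v. if a v \<le> b v then c v else d v)"
    by (rule ext) auto
  finally show ?thesis .
qed

text \<open>The default value \<open>y + 1\<close> exceeds the search bound, so comparing the result
  with \<open>y\<close> tells whether the search succeeded.\<close>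

lemma definable_bounded_min:
  assumes "definable (Suc m) f"
  shows "\<exists>\<mu>. definable (Suc m) \<mu> \<and> (\<forall>v y. length v = m \<longrightarrow>
    (\<mu> (v @ [y]) \<le> y \<longleftrightarrow> (\<exists>z\<le>y. f (v @ [z]) = 0)) \<and>
    (\<mu> (v @ [y]) \<le> y \<longrightarrow> f (v @ [\<mu> (v @ [y])]) = 0))"
proof (intro exI conjI allI impI)
  let ?\<mu> = "bounded_min m (restrict f (tuples (m + 1)))"
  show "definable (Suc m) ?\<mu>"
    using bounded_minimization[of "restrict f (tuples (m + 1))" m] assms
    by (auto simp: definable_def intro!: definable_of_mem[unfolded definable_def])
  fix v :: "nat list" and y
  assume v: "length v = m"
  have eq: "?\<mu> (v @ [y]) = (if \<exists>z\<le>y. f (v @ [z]) = 0 then LEAST z. z \<le> y \<and> f (v @ [z]) = 0 else y + 1)"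
    using v by (auto simp: bounded_min_def tuples_def cong: conj_cong)
  have L: "(LEAST z. z \<le> y \<and> f (v @ [z]) = 0) \<le> y \<and> f (v @ [LEAST z. z \<le> y \<and> f (v @ [z]) = 0]) = 0"
    if "\<exists>z\<le>y. f (v @ [z]) = 0"
    using LeastI_ex[of "\<lambda>z. z \<le> y \<and> f (v @ [z]) = 0"] that by blast
  show "?\<mu> (v @ [y]) \<le> y \<longleftrightarrow> (\<exists>z\<le>y. f (v @ [z]) = 0)"
    using L unfolding eq by (auto split: if_splits)
  show "?\<mu> (v @ [y]) \<le> y \<Longrightarrow> f (v @ [?\<mu> (v @ [y])]) = 0"
    using L unfolding eq by (auto split: if_splits)
qed

text \<open>The bound is the value at a maximizer, which bounded minimization finds.\<close>

lemma definable_bound: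
  assumes "definable 2 a"
  shows "\<exists>b. definable 1 b \<and> (\<forall>s z. z \<le> s \<longrightarrow> a [s, z] \<le> b [s])"
proof -
  \<comment> \<open>The term vanishes exactly if \<open>z\<close> gives a larger value than
    \<open>y\<close>; hence \<open>\<beta> [x, y, s] \<le> s\<close> says that \<open>y\<close> does
    not maximize \<open>a [x, z]\<close> over \<open>z \<le> s\<close>.\<close>
  have "definable (Suc 2) (\<lambda>v. Suc (a [v ! 0, v ! 1]) - a [v ! 0, v ! 2])"
    using assms by (intro definable_diff definable_Suc definable_subst2 definable_nth) auto
  from definable_bounded_min[OF this] obtain \<beta> where
    \<beta>: "definable (Suc 2) \<beta>" and "\<And>v y. length v = 2 \<Longrightarrow>
      (\<beta> (v @ [y]) \<le> y \<longleftrightarrow> (\<exists>z\<le>y. Suc (a [(v @ [z]) ! 0, (v @ [z]) ! 1]) - a [(v @ [z]) ! 0, (v @ [z]) ! 2] = 0))"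
    by blast
  from this(2)[of "[x, y]" for x y] have
    \<beta>_le: "\<beta> [x, y, s] \<le> s \<longleftrightarrow> (\<exists>z\<le>s. a [x, z] > a [x, y])" for x y s
    by (simp add: Suc_le_eq)
  \<comment> \<open>This term vanishes exactly if \<open>s < \<beta> [s, y, s]\<close>, that is, if
    \<open>a [s, z] \<le> a [s, y]\<close> for all \<open>z \<le> s\<close>. A second bounded search
    then finds such a \<open>y\<close>.\<close>
  have "definable (Suc 1) (\<lambda>v. Suc (v ! 0) - \<beta> (map (\<lambda>i. ([v ! 0, v ! 1, v ! 0] ! i)) [0..<Suc 2]))"
  proof (intro definable_diff definable_Suc definable_nth definable_subst \<beta>)
    fix i :: nat
    assume "i < Suc 2"
    then consider "i = 0" | "i = 1" | "i = 2"
      by linarith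
    then show "definable (Suc 1) (\<lambda>v. [v ! 0, v ! 1, v ! 0] ! i)"
      by cases (auto intro: definable_nth)
  qed simp
  then have "definable (Suc 1) (\<lambda>v. Suc (v ! 0) - \<beta> [v ! 0, v ! 1, v ! 0])"
    by (simp add: upt_rec)
  from definable_bounded_min[OF this] obtain \<mu> where
    \<mu>: "definable 2 \<mu>" and "\<And>v y. length v = 1 \<Longrightarrow>
      (\<mu> (v @ [y]) \<le> y \<longleftrightarrow> (\<exists>z\<le>y. Suc ((v @ [z]) ! 0) - \<beta> [(v @ [z]) ! 0, (v @ [z]) ! 1, (v @ [z]) ! 0] = 0)) \<and>
      (\<mu> (v @ [y]) \<le> y \<longrightarrow> Suc ((v @ [\<mu> (v @ [y])]) ! 0) -
        \<beta> [(v @ [\<mu> (v @ [y])]) ! 0, (v @ [\<mu> (v @ [y])]) ! 1, (v @ [\<mu> (v @ [y])]) ! 0] = 0)"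
    unfolding Suc_1[symmetric] by auto
  from this(2)[of "[s]" s for s] have
    \<mu>_le: "\<mu> [s, s] \<le> s \<longleftrightarrow> (\<exists>z\<le>s. s < \<beta> [s, z, s])" and
    \<mu>_eq: "\<mu> [s, s] \<le> s \<Longrightarrow> s < \<beta> [s, \<mu> [s, s], s]" for s
    by (simp_all add: Suc_le_eq)
  have "a [s, z] \<le> a [s, \<mu> [s, s]]" if "z \<le> s" for s z
  proof -
    obtain y where "y \<le> s" "\<forall>z\<le>s. a [s, z] \<le> a [s, y]"
    proof -
      let ?A = "(\<lambda>z. a [s, z]) ` {..s}"
      have "Max ?A \<in> ?A"
        by (rule Max_in) auto
      then show ?thesis
        using that Max_ge[of ?A] by fastforce
    qed
    then have "\<mu> [s, s] \<le> s"
      unfolding \<mu>_le using \<beta>_le[of s y s] by (meson not_le)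
    then have "s < \<beta> [s, \<mu> [s, s], s]"
      by (rule \<mu>_eq)
    then show ?thesis
      using \<beta>_le[of s "\<mu> [s, s]" s] that by (meson not_le)
  qed
  moreover have "definable 1 (\<lambda>v. a [v ! 0, \<mu> [v ! 0, v ! 0]])"
    using assms \<mu> by (intro definable_subst2 definable_nth) auto
  ultimately show ?thesis
    by (intro exI[of _ "\<lambda>v. a [v ! 0, \<mu> [v ! 0, v ! 0]]"]) simp
qed

lemma definable_apply_op:
  assumes "F \<in> \<O> n" "\<And>i. i < n \<Longrightarrow> definable (Suc m) (f i)"
  shows "definable (Suc m) (\<lambda>v. F (map (\<lambda>i t. f i (butlast v @ [t])) [0..<n]) (last v))"
proof -
  let ?fs = "map (\<lambda>i. restrict (f i) (tuples (m + 1))) [0..<n]"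
  have "(\<lambda>v\<in>tuples (m + 1). F (map (\<lambda>f t. f (butlast v @ [t])) ?fs) (last v)) \<in> \<F> (m + 1)"
    using assms unfolding definable_def Suc_eq_plus1 by (intro apply_op_to_functions) (auto simp: tuples_def[of n] simp del: restrict_apply)
  also have "(\<lambda>v\<in>tuples (m + 1). F (map (\<lambda>f t. f (butlast v @ [t])) ?fs) (last v)) =
      (\<lambda>v\<in>tuples (m + 1). F (map (\<lambda>i t. f i (butlast v @ [t])) [0..<n]) (last v))"
    by (rule restrict_ext) (simp add: tuples_def comp_def)
  finally show ?thesis
    unfolding definable_def Suc_eq_plus1 .
qed

section \<open>Definability of rounding and of moduli of uniformity\<close>

lemma definable_majorant:
  assumes "definable n a" "definable n b" "n > 0"
  shows "definable n (\<lambda>v. majorant (a v) (b v))"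
  unfolding majorant_def
  using assms by (intro definable_mult definable_add definable_const)

lemma definable_component_rounding:
  assumes "definable n p" "definable n q" "definable n r" "definable n t" "n > 0"
  shows "definable n (\<lambda>v. component j (rounding (t v) (p v, q v, r v)))"
proof -
  have "definable n (\<lambda>v. (p v - q v) * (2 * (t v + 1)) div (r v + 1))"
    "definable n (\<lambda>v. (q v - p v) * (2 * (t v + 1)) div (r v + 1))"
    "definable n (\<lambda>v. 2 * t v + 1)"
    using assms by - (intro definable_div definable_mult definable_diff definable_add definable_const; assumption)+
  then show ?thesis
    unfolding component_def rounding_def prod.case
    by (cases "j = 0"; cases "j = 1") (simp_all only: if_True if_False simp_thms one_neq_zero)
qed

text \<open>Uniformity is restricted to the family \<open>majorant s\<close>, so that the number
  \<open>s\<close> replaces the increasing function and the modulus becomes a function of two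
  numbers.\<close>

definition modulus :: "nat \<Rightarrow> op_on_funs \<Rightarrow> (nat list \<Rightarrow> nat) \<Rightarrow> bool"
  where "modulus n F \<omega> \<longleftrightarrow> (\<forall>s x fs fs'. length fs = n \<longrightarrow> length fs' = n \<longrightarrow>
    (\<forall>i<n. majorizes (majorant s) (fs ! i)) \<longrightarrow> (\<forall>i<n. majorizes (majorant s) (fs' ! i)) \<longrightarrow>
    (\<forall>i<n. \<forall>t\<le>\<omega> [s, x]. (fs ! i) t = (fs' ! i) t) \<longrightarrow> F fs x = F fs' x)"

text \<open>The operator \<open>\<Omega>\<close> from uniformity is applied to
  \<open>majorant s\<close>, which is definable with \<open>s\<close> as a parameter; applying an
  operator to such functions stays inside \<open>\<F>\<close>.\<close>

lemma ex_definable_modulus: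
  assumes "F \<in> \<O> n"
  shows "\<exists>\<omega>. definable 2 \<omega> \<and> modulus n F \<omega>"
proof -
  obtain \<Omega> where \<Omega>: "\<Omega> \<in> \<O> 1" "\<And>x g fs fs'. mono g \<Longrightarrow> fs \<in> tuples n \<Longrightarrow> fs' \<in> tuples n \<Longrightarrow>
      \<forall>i<n. majorizes g (fs ! i) \<and> majorizes g (fs' ! i) \<Longrightarrow>
      \<forall>i<n. \<forall>t\<le>\<Omega> [g] x. (fs ! i) t = (fs' ! i) t \<Longrightarrow> F fs x = F fs' x"
    using uniformity[OF assms] by metis
  let ?\<omega> = "\<lambda>v. \<Omega> [\<lambda>t. majorant (v ! 0) t] (v ! 1)"
  let ?\<omega>' = "\<lambda>v. \<Omega> (map (\<lambda>i t. majorant ((butlast v @ [t]) ! 0) ((butlast v @ [t]) ! 1)) [0..<1]) (last v)"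
  have "definable (Suc 1) ?\<omega>'"
    by (rule definable_apply_op[OF \<Omega>(1)]) (auto intro!: definable_majorant definable_nth)
  moreover have "?\<omega>' v = ?\<omega> v" if v: "length v = Suc 1" for v
  proof -
    obtain a b where "v = [a, b]"
      using v by (auto simp: length_Suc_conv numeral_2_eq_2)
    then show ?thesis
      by simp
  qed
  ultimately have "definable (Suc 1) ?\<omega>"
    using definable_cong[of "Suc 1" ?\<omega>' ?\<omega>] by blast
  then have "definable 2 ?\<omega>"
    by (simp add: numeral_2_eq_2)
  then show ?thesis
  unfolding modulus_def
  proof (intro exI[of _ ?\<omega>] conjI allI impI)
    fix s x fs fs'
    assume "length fs = n" "length fs' = n" "\<forall>i<n. majorizes (majorant s) (fs ! i)"
      "\<forall>i<n. majorizes (majorant s) (fs' ! i)" "\<forall>i<n. \<forall>t\<le>?\<omega> [s, x]. (fs ! i) t = (fs' ! i) t"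
    then show "F fs x = F fs' x"
      by (intro \<Omega>(2)[OF mono_majorant, of _ _ s]) (simp_all add: tuples_def)
  qed
qed

section \<open>Closure properties of the class of operators\<close>

definition op_definable :: "nat \<Rightarrow> op_on_funs \<Rightarrow> bool"
  where "op_definable n F \<longleftrightarrow> restrict F (tuples n) \<in> \<O> n"

lemma op_definable_id: "op_definable n (\<lambda>fs x. x)"
  using identity_op by (simp add: op_definable_def)

lemma op_definable_arg:
  assumes "op_definable n F" "j < n"
  shows "op_definable n (\<lambda>fs x. (fs ! j) (F fs x))"
proof -
  have "(\<lambda>fs\<in>tuples n. \<lambda>x. (fs ! j) (restrict F (tuples n) fs x)) \<in> \<O> n"
    using assms by (intro apply_argument_op) (auto simp: op_definable_def simp del: restrict_apply)
  also have "(\<lambda>fs\<in>tuples n. \<lambda>x. (fs ! j) (restrict F (tuples n) fs x)) =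
      (\<lambda>fs\<in>tuples n. \<lambda>x. (fs ! j) (F fs x))"
    by (rule restrict_ext) simp
  finally show ?thesis
    unfolding op_definable_def .
qed

lemma op_definable_fun:
  assumes "definable m a" "\<And>i. i < m \<Longrightarrow> op_definable n (G i)"
  shows "op_definable n (\<lambda>fs x. a (map (\<lambda>i. G i fs x) [0..<m]))"
proof -
  let ?Gs = "map (\<lambda>i. restrict (G i) (tuples n)) [0..<m]"
  have "(\<lambda>fs\<in>tuples n. \<lambda>x. restrict a (tuples m) (map (\<lambda>F. F fs x) ?Gs)) \<in> \<O> n"
    using assms unfolding definable_def op_definable_def by (intro apply_function_op) (auto simp: tuples_def[of m] simp del: restrict_apply)
  also have "(\<lambda>fs\<in>tuples n. \<lambda>x. restrict a (tuples m) (map (\<lambda>F. F fs x) ?Gs)) =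
      (\<lambda>fs\<in>tuples n. \<lambda>x. a (map (\<lambda>i. G i fs x) [0..<m]))"
    by (rule restrict_ext) (simp add: tuples_def comp_def)
  finally show ?thesis
    unfolding op_definable_def .
qed

lemma op_definable_fun1:
  assumes "definable 1 a" "op_definable n F"
  shows "op_definable n (\<lambda>fs x. a [F fs x])"
  using op_definable_fun[OF assms(1), of n "\<lambda>_. F"] assms(2) by simp

lemma op_definable_fun2:
  assumes "definable 2 a" "op_definable n F" "op_definable n G"
  shows "op_definable n (\<lambda>fs x. a [F fs x, G fs x])"
  using op_definable_fun[OF assms(1), of n "\<lambda>i. if i = 0 then F else G"] assms(2,3)
  by (simp add: upt_rec)

lemma op_definable_fun_append:
  assumes "definable (m + l) a" "\<And>i. i < m \<Longrightarrow> op_definable n (F i)" "\<And>i. i < l \<Longrightarrow> op_definable n (G i)"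
  shows "op_definable n (\<lambda>fs x. a (map (\<lambda>i. F i fs x) [0..<m] @ map (\<lambda>i. G i fs x) [0..<l]))"
proof -
  let ?c = "\<lambda>i. if i < m then F i else G (i - m)"
  have "map (\<lambda>i. ?c i fs x) [0..<m + l] = map (\<lambda>i. F i fs x) [0..<m] @ map (\<lambda>i. G i fs x) [0..<l]" for fs x
    by (rule nth_equalityI) (auto simp: nth_append)
  then show ?thesis
    using op_definable_fun[OF assms(1), of n ?c] assms(2,3) by simp
qed

lemma op_definable_const: "op_definable n (\<lambda>fs x. c)"
  using op_definable_fun1[OF definable_const op_definable_id] by simp

lemma op_definable_add:
  assumes "op_definable n F" "op_definable n G"
  shows "op_definable n (\<lambda>fs x. F fs x + G fs x)"
  using op_definable_fun2[of "\<lambda>v. v ! 0 + v ! 1"] assms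
  by (simp add: definable_add definable_nth)

lemma op_definable_diff:
  assumes "op_definable n F" "op_definable n G"
  shows "op_definable n (\<lambda>fs x. F fs x - G fs x)"
  using op_definable_fun2[of "\<lambda>v. v ! 0 - v ! 1"] assms
  by (simp add: definable_diff definable_nth)

lemma op_definable_sum:
  assumes "\<And>i. i < m \<Longrightarrow> op_definable n (F i)"
  shows "op_definable n (\<lambda>fs x. \<Sum>i<m::nat. F i fs x)"
  using assms
proof (induction m)
  case (Suc m)
  then have "op_definable n (\<lambda>fs x. (\<Sum>i<m. F i fs x) + F m fs x)"
    by (intro op_definable_add) auto
  then show ?case
    by simp
qed (simp add: op_definable_const)

lemma mem_of_definable:
  assumes "definable n f"
  obtains f' where "f' \<in> \<F> n" "\<And>v. length v = n \<Longrightarrow> f' v = f v"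
  using assms that[of "restrict f (tuples n)"] by (simp add: definable_def tuples_def)

lemma mem_of_op_definable:
  assumes "op_definable n F"
  obtains F' where "F' \<in> \<O> n" "\<And>fs. length fs = n \<Longrightarrow> F' fs = F fs"
  using assms that[of "restrict F (tuples n)"] by (simp add: op_definable_def tuples_def)

text \<open>For one list of triples the rounded functions depend on \<open>t\<close> with the
  \<open>3 * k\<close> entries as parameters, so the value of \<open>E\<close> at them is a
  definable function of these entries and of \<open>z\<close>.\<close>

lemma definable_op_rounded:
  assumes "E \<in> \<O> (3 * k)"
  shows "\<exists>e. definable (Suc (3 * k)) e \<and>
    (\<forall>ps z. length ps = k \<longrightarrow> e (flat ps @ [z]) = E (rounded_funs k (\<lambda>_. ps)) z)"
proof -
  \<comment> \<open>Position \<open>3 * k\<close> holds the precision, the variable bound by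
    \<open>E\<close>.\<close>
  define f where "f i v = component (i mod 3) (rounding (v ! (3 * k))
    (v ! (3 * (i div 3)), v ! (3 * (i div 3) + 1), v ! (3 * (i div 3) + 2)))" for i v
  define e where "e v = E (map (\<lambda>i t. f i (butlast v @ [t])) [0..<3 * k]) (last v)" for v
  have "definable (Suc (3 * k)) (f i)" if "i < 3 * k" for i
  proof -
    have "3 * (i div 3) + 2 < Suc (3 * k)"
      using that by presburger
    then show ?thesis
      unfolding f_def by (intro definable_component_rounding definable_nth) linarith+
  qed
  then have "definable (Suc (3 * k)) e"
    unfolding e_def by (rule definable_apply_op[OF assms])
  moreover have "e (flat ps @ [z]) = E (rounded_funs k (\<lambda>_. ps)) z" if ps: "length ps = k" for ps z
  proof -
    have "f i (flat ps @ [t]) = (rounded_funs k (\<lambda>_. ps) ! i) t" if "i < 3 * k" for i t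
    proof -
      have "i div 3 < k" "3 * (i div 3) + 2 < 3 * k"
        using that by presburger+
      then show ?thesis
        using that ps triple_nth_flat[of "i div 3" ps] by (simp add: f_def nth_append nth_rounded_funs)
    qed
    then have "map (\<lambda>i t. f i (flat ps @ [t])) [0..<3 * k] = rounded_funs k (\<lambda>_. ps)"
      by (intro nth_equalityI) auto
    then show ?thesis
      by (simp add: e_def)
  qed
  ultimately show ?thesis
    by blast
qed

text \<open>The same principle applies with parameters \<open>ps0\<close>, \<open>ps\<close> and
  \<open>s\<close>: choosing between the two lists by comparing the precision with
  \<open>N [s]\<close> is a definable case distinction.\<close>

lemma definable_op_rounded_switch:
  assumes F: "F \<in> \<O> (3 * k + 1)" and N: "definable 1 N" and Z: "definable (3 * k + 1) Z"
  shows "\<exists>f\<in>\<F> (6 * k + 2). \<forall>ps0 ps s t. length ps0 = k \<longrightarrow> length ps = k \<longrightarrow>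
    f (flat ps0 @ flat ps @ [s, t]) =
    F (rounded_funs k (\<lambda>x. if x \<le> N [s] then ps0 else ps) @ [\<lambda>_. Z (flat ps0 @ [s])]) t"
proof -
  define m where "m = 6 * k + 1"
  \<comment> \<open>The positions are laid out as \<open>ps0\<close> below \<open>3 * k\<close>,
    then \<open>ps\<close> below \<open>6 * k\<close>, then \<open>s\<close> at
    \<open>6 * k\<close>; the last one, \<open>6 * k + 1\<close>, is the precision bound by
    \<open>F\<close>.\<close>
  define c where "c j v = (if v ! (6 * k + 1) \<le> N [v ! (6 * k)] then v ! j else v ! (3 * k + j))" for j v
  define f where "f i v = (if i = 3 * k then Z (map (\<lambda>j. v ! j) [0..<3 * k] @ map (\<lambda>_. v ! (6 * k)) [0..<1])
    else component (i mod 3) (rounding (v ! (6 * k + 1))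
      (c (3 * (i div 3)) v, c (3 * (i div 3) + 1) v, c (3 * (i div 3) + 2) v)))" for i v
  define e where "e v = F (map (\<lambda>i t. f i (butlast v @ [t])) [0..<3 * k + 1]) (last v)" for v
  have c: "definable (Suc m) (c j)" if "j < 3 * k" for j
    unfolding c_def m_def using that
    by (intro definable_if_le definable_nth definable_subst1[OF N]) auto
  have "definable (Suc m) (f i)" if "i < 3 * k + 1" for i
  proof (cases "i = 3 * k")
    case True
    have "definable (Suc m) (\<lambda>v. Z (map (\<lambda>j. v ! j) [0..<3 * k] @ map (\<lambda>_. v ! (6 * k)) [0..<1]))"
      by (rule definable_subst_append[OF Z]) (auto simp: m_def intro: definable_nth)
    with True show ?thesis
      by (simp only: f_def[abs_def] if_True simp_thms)
  next
    case False
    then have "3 * (i div 3) + 2 < 3 * k"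
      using that by presburger
    then have "definable (Suc m) (\<lambda>v. component (i mod 3) (rounding (v ! (6 * k + 1))
      (c (3 * (i div 3)) v, c (3 * (i div 3) + 1) v, c (3 * (i div 3) + 2) v)))"
      by (intro definable_component_rounding definable_nth c) (simp_all add: m_def)
    with False show ?thesis
      unfolding f_def by simp
  qed
  then have "definable (Suc m) e"
    unfolding e_def by (rule definable_apply_op[OF F])
  moreover have "e (flat ps0 @ flat ps @ [s, t]) =
      F (rounded_funs k (\<lambda>x. if x \<le> N [s] then ps0 else ps) @ [\<lambda>_. Z (flat ps0 @ [s])]) t"
    if ps: "length ps0 = k" "length ps = k" for ps0 ps s t
  proof -
    let ?v = "\<lambda>x. flat ps0 @ flat ps @ [s, x]"
    have c_eq: "c j (?v x) = (if x \<le> N [s] then flat ps0 ! j else flat ps ! j)" if "j < 3 * k" for j x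
      using that ps by (simp add: c_def nth_append)
    have "f i (?v x) = (rounded_funs k (\<lambda>x. if x \<le> N [s] then ps0 else ps) ! i) x" if "i < 3 * k" for i x
    proof -
      have "i div 3 < k" "3 * (i div 3) + 2 < 3 * k"
        using that by presburger+
      then show ?thesis
        using that ps triple_nth_flat[of "i div 3" ps] triple_nth_flat[of "i div 3" ps0]
        by (simp add: f_def c_eq nth_rounded_funs) (simp add: nth_append)
    qed
    moreover have "f (3 * k) (?v x) = Z (flat ps0 @ [s])" for x
    proof -
      have "map (\<lambda>j. ?v x ! j) [0..<3 * k] = flat ps0"
        using ps by (intro nth_equalityI) (auto simp: nth_append)
      moreover have "?v x ! (6 * k) = s"
        using ps by (simp add: nth_append)
      ultimately show ?thesis
        by (simp add: f_def)
    qed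
    ultimately have "map (\<lambda>i x. f i (?v x)) [0..<3 * k + 1] =
        rounded_funs k (\<lambda>x. if x \<le> N [s] then ps0 else ps) @ [\<lambda>_. Z (flat ps0 @ [s])]"
      by (intro nth_equalityI) (auto simp: nth_append less_Suc_eq simp del: upt_Suc)
    moreover have "butlast (?v t) @ [x] = ?v x" for x
      by (simp add: butlast_append)
    ultimately show ?thesis
      by (simp add: e_def del: upt_Suc)
  qed
  ultimately show ?thesis
    unfolding definable_def
    by (intro bexI[of _ "restrict e (tuples (6 * k + 2))"]) (simp_all add: m_def tuples_def)
qed


section \<open>The two implications\<close>

lemma operator_computable_of_TZ:
  assumes "conditionally_computable_TZ \<F> k D \<theta>" "D \<subseteq> tuples k"
  shows "conditionally_operator_computable \<O> k D \<theta>"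
proof -
  obtain d0 d e f g h where mem: "d0 \<in> \<F> 1" "d \<in> \<F> 2" "e \<in> \<F> (3 * k + 1)"
      "f \<in> \<F> (6 * k + 2)" "g \<in> \<F> (6 * k + 2)" "h \<in> \<F> (6 * k + 2)"
    and A: "\<And>\<xi>. \<xi> \<in> D \<Longrightarrow> \<exists>s0. \<forall>s\<ge>s0. \<forall>ps0. approximates (d0 [s]) ps0 \<xi> \<longrightarrow> e (flat ps0 @ [s]) = 0"
    and B: "\<And>\<xi> s t ps0 ps. \<lbrakk>\<xi> \<in> D; approximates (d0 [s]) ps0 \<xi>; e (flat ps0 @ [s]) = 0;
      \<forall>x\<in>set \<xi>. \<bar>x\<bar> \<le> real s + 1; approximates (d [s, t]) ps \<xi>\<rbrakk> \<Longrightarrow>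
      \<bar>triple_value (f (flat ps0 @ flat ps @ [s, t]), g (flat ps0 @ flat ps @ [s, t]),
        h (flat ps0 @ flat ps @ [s, t])) - \<theta> \<xi>\<bar> < 1 / (real t + 1)"
    using assms(1) unfolding conditionally_computable_TZ_def Let_def by (elim bexE) blast
  \<comment> \<open>A sum of natural numbers vanishes only if all its terms do, so the zeros of
    \<open>E\<close> combine \<open>e = 0\<close> with the bounds needed for
    \<open>names_imp_bound_abs\<close>.\<close>
  define E where "E = (\<lambda>fs s. e (map (\<lambda>i. (fs ! i) (d0 [s])) [0..<3 * k] @ [s]) +
    (\<Sum>i<3 * k. (fs ! i) (0 :: nat) - s))"
  \<comment> \<open>The number \<open>s\<close> is recovered from the last argument function, which
    will be constant, by evaluating it at \<open>t\<close>.\<close>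
  define V where "V fs t = map (\<lambda>i. (fs ! i) (d0 [(fs ! (3 * k)) t])) [0..<3 * k] @
    map (\<lambda>i. (fs ! i) (d [(fs ! (3 * k)) t, t])) [0..<3 * k] @ [(fs ! (3 * k)) t, t]" for fs t
  have "op_definable (3 * k) E"
  proof -
    have "op_definable (3 * k) (\<lambda>fs s. e (map (\<lambda>i. (fs ! i) (d0 [s])) [0..<3 * k] @ map (\<lambda>i. s) [0..<1]))"
      by (rule op_definable_fun_append)
        (use mem in \<open>auto intro!: op_definable_arg op_definable_fun1 op_definable_id definable_of_mem\<close>)
    then show ?thesis
      unfolding E_def
      by (intro op_definable_add op_definable_sum op_definable_diff op_definable_arg op_definable_const
          op_definable_id) auto
  qed
  then obtain E' where E': "E' \<in> \<O> (3 * k)" "\<And>fs. length fs = 3 * k \<Longrightarrow> E' fs = E fs"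
    by (rule mem_of_op_definable) blast
  have V: "\<exists>F'. F' \<in> \<O> (3 * k + 1) \<and> (\<forall>fs. length fs = 3 * k + 1 \<longrightarrow> F' fs = (\<lambda>t. a (V fs t)))"
    if a: "a \<in> \<F> (6 * k + 2)" for a
  proof -
    let ?c = "\<lambda>i fs t. if i < 3 * k then (fs ! i) (d0 [(fs ! (3 * k)) t])
      else if i < 6 * k then (fs ! (i - 3 * k)) (d [(fs ! (3 * k)) t, t])
      else if i = 6 * k then (fs ! (3 * k)) t else t"
    have "op_definable (3 * k + 1) (?c i)" if "i < 6 * k + 2" for i
    proof -
      have s: "op_definable (3 * k + 1) (\<lambda>fs t. (fs ! (3 * k)) t)"
        by (intro op_definable_arg op_definable_id) simp
      have "op_definable (3 * k + 1) (\<lambda>fs t. d0 [(fs ! (3 * k)) t])"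
        "op_definable (3 * k + 1) (\<lambda>fs t. d [(fs ! (3 * k)) t, t])"
        using mem s by (auto intro!: op_definable_fun1 op_definable_fun2 op_definable_id definable_of_mem)
      then have "i < 3 * k \<Longrightarrow> op_definable (3 * k + 1) (\<lambda>fs t. (fs ! i) (d0 [(fs ! (3 * k)) t]))"
        "i < 6 * k \<Longrightarrow> op_definable (3 * k + 1) (\<lambda>fs t. (fs ! (i - 3 * k)) (d [(fs ! (3 * k)) t, t]))"
        by - (rule op_definable_arg; force)+
      with s show ?thesis
        by (cases "i < 3 * k"; cases "i < 6 * k"; cases "i = 6 * k")
          (simp_all only: if_True if_False simp_thms op_definable_id)
    qed
    then have "op_definable (3 * k + 1) (\<lambda>fs t. a (map (\<lambda>i. ?c i fs t) [0..<6 * k + 2]))"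
      by (rule op_definable_fun[OF definable_of_mem[OF a], of "3 * k + 1" ?c])
    then obtain F where F: "F \<in> \<O> (3 * k + 1)"
      "\<And>fs. length fs = 3 * k + 1 \<Longrightarrow> F fs = (\<lambda>t. a (map (\<lambda>i. ?c i fs t) [0..<6 * k + 2]))"
      by (rule mem_of_op_definable) blast
    have "map (\<lambda>i. ?c i fs t) [0..<6 * k + 2] = V fs t" for fs t
    proof (rule nth_equalityI)
      fix i
      assume "i < length (map (\<lambda>i. ?c i fs t) [0..<6 * k + 2])"
      then have "i < 3 * k \<or> 3 * k \<le> i \<and> i < 6 * k \<or> i = 6 * k \<or> i = 6 * k + 1"
        by auto
      then show "map (\<lambda>i. ?c i fs t) [0..<6 * k + 2] ! i = V fs t ! i"
        by (auto simp: V_def nth_append simp del: upt_Suc)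
    qed (simp add: V_def)
    then show ?thesis
      using F by auto
  qed
  obtain F where F: "F \<in> \<O> (3 * k + 1)"
    "\<And>fs. length fs = 3 * k + 1 \<Longrightarrow> F fs = (\<lambda>t. f (V fs t))"
    using V[OF mem(4)] by blast
  obtain G where G: "G \<in> \<O> (3 * k + 1)"
    "\<And>fs. length fs = 3 * k + 1 \<Longrightarrow> G fs = (\<lambda>t. g (V fs t))"
    using V[OF mem(5)] by blast
  obtain H where H: "H \<in> \<O> (3 * k + 1)"
    "\<And>fs. length fs = 3 * k + 1 \<Longrightarrow> H fs = (\<lambda>t. h (V fs t))"
    using V[OF mem(6)] by blast
  have "(\<exists>s. E' (flat ts) s = 0) \<and> (\<forall>s. E' (flat ts) s = 0 \<longrightarrow>
      names (F (flat ts @ [\<lambda>x. s]), G (flat ts @ [\<lambda>x. s]), H (flat ts @ [\<lambda>x. s])) (\<theta> \<xi>))"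
    if \<xi>: "\<xi> \<in> D" and ts: "list_all2 names ts \<xi>" for \<xi> ts
  proof (intro conjI allI impI)
    define P where "P n = map (\<lambda>(a :: nat \<Rightarrow> nat, b :: nat \<Rightarrow> nat, c :: nat \<Rightarrow> nat). (a n, b n, c n)) ts" for n
    have P: "approximates n (P n) \<xi>" for n
      unfolding P_def by (rule names_imp_approximates[OF ts])
    have len: "length ts = k"
      using list_all2_lengthD[OF ts] \<xi> assms(2) by (auto simp: tuples_def)
    have flat_P: "map (\<lambda>i. (flat ts ! i) n) [0..<3 * k] = flat (P n)" for n
      unfolding P_def by (rule flat_map_triple[OF len])
    have E'_eq: "E' (flat ts) s = e (flat (P (d0 [s])) @ [s]) + (\<Sum>i<3 * k. (flat ts ! i) 0 - s)" for s
      using E'(2)[of "flat ts"] by (simp add: len E_def flat_P)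
    show "\<exists>s. E' (flat ts) s = 0"
    proof -
      obtain s0 where s0: "\<And>s ps0. s \<ge> s0 \<Longrightarrow> approximates (d0 [s]) ps0 \<xi> \<Longrightarrow> e (flat ps0 @ [s]) = 0"
        using A[OF \<xi>] by blast
      \<comment> \<open>Adding the sum makes \<open>s\<close> dominate every entry at precision 0
        while keeping \<open>s \<ge> s0\<close>.\<close>
      define s where "s = s0 + (\<Sum>i<3 * k. (flat ts ! i) 0)"
      have "(flat ts ! i) 0 \<le> s" if "i < 3 * k" for i
        using member_le_sum[of i "{..<3 * k}" "\<lambda>i. (flat ts ! i) 0"] that by (simp add: s_def trans_le_add2)
      moreover have "e (flat (P (d0 [s])) @ [s]) = 0"
        by (rule s0[OF _ P]) (simp add: s_def)
      ultimately show ?thesis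
        unfolding E'_eq by (intro exI[of _ s]) simp
    qed
    fix s
    assume "E' (flat ts) s = 0"
    then have s: "e (flat (P (d0 [s])) @ [s]) = 0" "\<And>i. i < 3 * k \<Longrightarrow> (flat ts ! i) 0 \<le> s"
      unfolding E'_eq by simp_all
    have bound: "\<forall>x\<in>set \<xi>. \<bar>x\<bar> \<le> real s + 1"
      using names_imp_bound_abs[OF ts] s(2) len by blast
    have "V (flat ts @ [\<lambda>x. s]) t = flat (P (d0 [s])) @ flat (P (d [s, t])) @ [s, t]" for t
    proof -
      have "map (\<lambda>i. ((flat ts @ [\<lambda>x. s]) ! i) n) [0..<3 * k] = map (\<lambda>i. (flat ts ! i) n) [0..<3 * k]" for n
        by (simp add: nth_append len)
      then show ?thesis
        by (simp add: V_def nth_append len flat_P)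
    qed
    then show "names (F (flat ts @ [\<lambda>x. s]), G (flat ts @ [\<lambda>x. s]), H (flat ts @ [\<lambda>x. s])) (\<theta> \<xi>)"
      using B[OF \<xi> P s(1) bound P] by (simp add: F G H len del: triple_value.simps)
  qed
  then show ?thesis
    unfolding conditionally_operator_computable_def using E'(1) F(1) G(1) H(1) by blast
qed

text \<open>The coarse precision \<open>2 * N [s] + 1\<close> suffices to evaluate \<open>E\<close>
  at all \<open>z \<le> s\<close>, and the fine precision \<open>2 * M [s, t] + 1\<close> suffices
  for \<open>F\<close>, \<open>G\<close>, \<open>H\<close> at \<open>t\<close>.\<close>

lemma TZ_of_operator_computable:
  assumes "conditionally_operator_computable \<O> k D \<theta>" "D \<subseteq> tuples k"
  shows "conditionally_computable_TZ \<F> k D \<theta>"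
proof -
  obtain E F G H where mem: "E \<in> \<O> (3 * k)" "F \<in> \<O> (3 * k + 1)" "G \<in> \<O> (3 * k + 1)" "H \<in> \<O> (3 * k + 1)"
    and ex: "\<And>\<xi> ts. \<xi> \<in> D \<Longrightarrow> list_all2 names ts \<xi> \<Longrightarrow> \<exists>s. E (flat ts) s = 0"
    and nm: "\<And>\<xi> ts s. \<xi> \<in> D \<Longrightarrow> list_all2 names ts \<xi> \<Longrightarrow> E (flat ts) s = 0 \<Longrightarrow>
      names (F (flat ts @ [\<lambda>x. s]), G (flat ts @ [\<lambda>x. s]), H (flat ts @ [\<lambda>x. s])) (\<theta> \<xi>)"
    using assms(1) unfolding conditionally_operator_computable_def by (elim bexE) blast
  obtain \<omega> where \<omega>: "definable 2 \<omega>" and \<omega>_E: "modulus (3 * k) E \<omega>"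
    using ex_definable_modulus[OF mem(1)] by blast
  \<comment> \<open>One bound for all \<open>z \<le> s\<close> lets a single coarse approximation
    serve the whole search for a zero of \<open>E\<close>.\<close>
  obtain N where N: "definable 1 N" and N_ge: "\<And>s z. z \<le> s \<Longrightarrow> \<omega> [s, z] \<le> N [s]"
    using definable_bound[OF \<omega>] by blast
  obtain e0 where e0: "definable (Suc (3 * k)) e0"
    "\<And>ps z. length ps = k \<Longrightarrow> e0 (flat ps @ [z]) = E (rounded_funs k (\<lambda>_. ps)) z"
    using definable_op_rounded[OF mem(1)] by blast
  \<comment> \<open>\<open>Z\<close> searches up to \<open>s\<close> for a zero of \<open>E\<close>
    at the rounded list; a value above \<open>s\<close> signals failure.\<close>
  obtain Z where Z: "definable (Suc (3 * k)) Z"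
    and Z_min: "\<And>v y. length v = 3 * k \<Longrightarrow> (Z (v @ [y]) \<le> y \<longleftrightarrow> (\<exists>z\<le>y. e0 (v @ [z]) = 0)) \<and>
      (Z (v @ [y]) \<le> y \<longrightarrow> e0 (v @ [Z (v @ [y])]) = 0)"
    using definable_bounded_min[OF e0(1)] by blast
  have Z_le: "Z (flat ps @ [s]) \<le> s \<longleftrightarrow> (\<exists>z\<le>s. E (rounded_funs k (\<lambda>_. ps)) z = 0)"
    and Z_zero: "Z (flat ps @ [s]) \<le> s \<Longrightarrow> E (rounded_funs k (\<lambda>_. ps)) (Z (flat ps @ [s])) = 0"
    if "length ps = k" for ps s
    using that Z_min[of "flat ps" s] by (simp_all add: e0(2))
  have D: "length \<xi> = k" if "\<xi> \<in> D" for \<xi>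
    using that assms(2) by (auto simp: tuples_def)

  \<comment> \<open>Both argument lists are majorized by \<open>majorant s\<close> and agree up to
    \<open>N [s]\<close>, so the modulus of \<open>E\<close> identifies the values at every
    \<open>z \<le> s\<close>.\<close>
  have E_const: "E (rounded_funs k (\<lambda>_. ps)) z = E (rounded_funs k \<psi>) z"
    if "length \<xi> = k" "\<forall>x\<in>set \<xi>. \<bar>x\<bar> \<le> real s + 1" "approximates (2 * N [s] + 1) ps \<xi>" "z \<le> s"
      "\<And>t. approximates (2 * t + 1) (\<psi> t) \<xi>" "\<And>t. t \<le> N [s] \<Longrightarrow> \<psi> t = ps" for \<xi> s ps z \<psi>
  proof (rule \<omega>_E[unfolded modulus_def, rule_format, where s = s])
    show "majorizes (majorant s) (rounded_funs k (\<lambda>_. ps) ! i)" if "i < 3 * k" for i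
      using \<open>approximates (2 * N [s] + 1) ps \<xi>\<close> \<open>\<forall>x\<in>set \<xi>. \<bar>x\<bar> \<le> real s + 1\<close> \<open>length \<xi> = k\<close> that
      by (rule majorizes_rounded_funs[of "\<lambda>_. 2 * N [s] + 1"])
    show "majorizes (majorant s) (rounded_funs k \<psi> ! i)" if "i < 3 * k" for i
      using \<open>\<And>t. approximates (2 * t + 1) (\<psi> t) \<xi>\<close> \<open>\<forall>x\<in>set \<xi>. \<bar>x\<bar> \<le> real s + 1\<close> \<open>length \<xi> = k\<close> that
      by (rule majorizes_rounded_funs)
    show "(rounded_funs k (\<lambda>_. ps) ! i) t = (rounded_funs k \<psi> ! i) t" if "i < 3 * k" "t \<le> \<omega> [s, z]" for i t
      using that \<open>\<And>t. t \<le> N [s] \<Longrightarrow> \<psi> t = ps\<close> N_ge[OF \<open>z \<le> s\<close>]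
      by (intro rounded_funs_cong) auto
  qed simp_all

  have A: "\<exists>s0. \<forall>s\<ge>s0. \<forall>ps. approximates (2 * N [s] + 1) ps \<xi> \<longrightarrow> Z (flat ps @ [s]) \<le> s" if \<xi>: "\<xi> \<in> D" for \<xi>
  proof -
    obtain S :: nat where S: "\<forall>x\<in>set \<xi>. \<bar>x\<bar> \<le> real S + 1"
      using ex_bound_abs by blast
    \<comment> \<open>The tree is built from the fixed bound \<open>S\<close> on
      \<open>\<xi>\<close>, so the resulting \<open>z0\<close> is independent of \<open>s\<close>;
      its branches yield names of \<open>\<xi>\<close>.\<close>
    let ?A = "\<lambda>t. {as. length as = k \<and> (\<forall>i<k. \<forall>j. component j (as ! i) \<le> majorant S t) \<and> approximates t as \<xi>}"
    have "\<exists>z0. \<forall>\<phi>. (\<forall>t. \<phi> t \<in> ?A t) \<longrightarrow> (\<exists>z\<le>z0. E (flat (unzip k \<phi>)) z = 0)"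
    proof (rule bounded_witness_of_finite_branching)
      show "finite (?A t)" for t
        by (rule finite_subset[OF _ finite_bounded_triple_lists[of k "majorant S t"]]) auto
      show "\<exists>z. E (flat (unzip k \<phi>)) z = 0" if "\<forall>t. \<phi> t \<in> ?A t" for \<phi>
        using that names_unzip_iff[of \<xi> k \<phi>] D[OF \<xi>] by (intro ex[OF \<xi>]) simp
      fix \<phi> :: "nat \<Rightarrow> (nat \<times> nat \<times> nat) list" and z
      assume E0: "E (flat (unzip k \<phi>)) z = 0"
      obtain n where n: "\<forall>gs\<in>tuples (3 * k). (\<forall>i<3 * k. \<forall>t\<le>n. (gs ! i) t = (flat (unzip k \<phi>) ! i) t) \<longrightarrow>
          E gs z = E (flat (unzip k \<phi>)) z"
        using continuity[OF mem(1), of "flat (unzip k \<phi>)" z] by (auto simp: tuples_def)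
      have "E (flat (unzip k \<psi>)) z = 0" if "\<forall>t<Suc n. \<psi> t = \<phi> t" for \<psi>
        using n[rule_format, of "flat (unzip k \<psi>)"] that E0 by (simp add: tuples_def nth_flat_unzip)
      then show "\<exists>n. \<forall>\<psi>. (\<forall>t<n. \<psi> t = \<phi> t) \<longrightarrow> E (flat (unzip k \<psi>)) z = 0"
        by blast
    qed
    then obtain z0 where z0: "\<And>\<phi>. (\<And>t. \<phi> t \<in> ?A t) \<Longrightarrow> \<exists>z\<le>z0. E (flat (unzip k \<phi>)) z = 0"
      by blast
    \<comment> \<open>From \<open>z0\<close> on the search range contains the uniform witness, and
      from \<open>S\<close> on \<open>majorant s\<close> is valid for \<open>\<xi>\<close>. The
      rounded \<open>\<psi>\<close> is a branch of the tree, and \<open>E_const\<close> carries its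
      zero over to \<open>ps\<close>.\<close>
    have "Z (flat ps @ [s]) \<le> s" if s: "max z0 S \<le> s" and ps: "approximates (2 * N [s] + 1) ps \<xi>" for s ps
    proof -
      obtain \<psi> where \<psi>: "list_all2 names (unzip k (\<lambda>t. map (rounding t) (\<psi> t))) \<xi>"
        "\<And>t. approximates (2 * t + 1) (\<psi> t) \<xi>" "\<And>t. t \<le> N [s] \<Longrightarrow> \<psi> t = ps"
        using ex_names_extending[of "\<lambda>_. 2 * N [s] + 1" "\<lambda>_. ps" \<xi> k] ps D[OF \<xi>] by auto
      have "map (rounding t) (\<psi> t) \<in> ?A t" for t
        using approximates_rounding[OF \<psi>(2)[of t]] approximates_rounding_le[OF \<psi>(2)[of t] S]
          approximates_length[OF \<psi>(2)[of t]] D[OF \<xi>] by simp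
      from z0[OF this] obtain z where "z \<le> z0" "E (rounded_funs k \<psi>) z = 0"
        unfolding rounded_funs_def by blast
      moreover have "\<forall>x\<in>set \<xi>. \<bar>x\<bar> \<le> real s + 1"
        using S s by force
      ultimately have "z \<le> s" "E (rounded_funs k (\<lambda>_. ps)) z = 0"
        using E_const[OF D[OF \<xi>] _ ps _ \<psi>(2,3), of z] s by auto
      then show ?thesis
        using Z_le[of ps s] approximates_length[OF ps] D[OF \<xi>] by auto
    qed
    then show ?thesis
      by blast
  qed

  obtain \<omega>\<^sub>F where \<omega>\<^sub>F: "definable 2 \<omega>\<^sub>F" and F_cong: "modulus (3 * k + 1) F \<omega>\<^sub>F"
    using ex_definable_modulus[OF mem(2)] by blast
  obtain \<omega>\<^sub>G where \<omega>\<^sub>G: "definable 2 \<omega>\<^sub>G" and G_cong: "modulus (3 * k + 1) G \<omega>\<^sub>G"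
    using ex_definable_modulus[OF mem(3)] by blast
  obtain \<omega>\<^sub>H where \<omega>\<^sub>H: "definable 2 \<omega>\<^sub>H" and H_cong: "modulus (3 * k + 1) H \<omega>\<^sub>H"
    using ex_definable_modulus[OF mem(4)] by blast
  \<comment> \<open>The sum dominates all three moduli and is definable.\<close>
  define M where "M v = \<omega>\<^sub>F [v ! 0, v ! 1] + \<omega>\<^sub>G [v ! 0, v ! 1] + \<omega>\<^sub>H [v ! 0, v ! 1]" for v
  \<comment> \<open>Up to \<open>N [s]\<close> the coarse approximation is kept: otherwise the zero \<open>Z (flat ps0 @ [s])\<close> of \<open>E\<close>
    at \<open>ps0\<close> need not be a zero of \<open>E\<close> at the name that \<open>\<Phi>\<close> imitates.\<close>
  define \<Phi> where "\<Phi> ps0 ps s = rounded_funs k (\<lambda>x. if x \<le> N [s] then ps0 else ps) @ [\<lambda>_. Z (flat ps0 @ [s])]" for ps0 ps s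
  have switch: "\<exists>f\<in>\<F> (6 * k + 2). \<forall>ps0 ps s t. length ps0 = k \<longrightarrow> length ps = k \<longrightarrow>
      f (flat ps0 @ flat ps @ [s, t]) = F (\<Phi> ps0 ps s) t" if "F \<in> \<O> (3 * k + 1)" for F
    unfolding \<Phi>_def using that N Z by (intro definable_op_rounded_switch) simp_all
  obtain f where f: "f \<in> \<F> (6 * k + 2)" "\<And>ps0 ps s t. length ps0 = k \<Longrightarrow> length ps = k \<Longrightarrow>
      f (flat ps0 @ flat ps @ [s, t]) = F (\<Phi> ps0 ps s) t"
    using switch[OF mem(2)] by blast
  obtain g where g: "g \<in> \<F> (6 * k + 2)" "\<And>ps0 ps s t. length ps0 = k \<Longrightarrow> length ps = k \<Longrightarrow>
      g (flat ps0 @ flat ps @ [s, t]) = G (\<Phi> ps0 ps s) t"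
    using switch[OF mem(3)] by blast
  obtain h where h: "h \<in> \<F> (6 * k + 2)" "\<And>ps0 ps s t. length ps0 = k \<Longrightarrow> length ps = k \<Longrightarrow>
      h (flat ps0 @ flat ps @ [s, t]) = H (\<Phi> ps0 ps s) t"
    using switch[OF mem(4)] by blast

  have B: "\<bar>triple_value (F (\<Phi> ps0 ps s) t, G (\<Phi> ps0 ps s) t, H (\<Phi> ps0 ps s) t) - \<theta> \<xi>\<bar> < 1 / (real t + 1)"
    if \<xi>: "\<xi> \<in> D" and ps0: "approximates (2 * N [s] + 1) ps0 \<xi>" and Z0: "Z (flat ps0 @ [s]) \<le> s"
      and s: "\<forall>x\<in>set \<xi>. \<bar>x\<bar> \<le> real s + 1" and ps: "approximates (2 * M [s, t] + 1) ps \<xi>" for \<xi> ps0 ps s t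
  proof -
    let ?\<phi> = "\<lambda>x. if x \<le> N [s] then ps0 else ps"
    let ?z = "Z (flat ps0 @ [s])"
    \<comment> \<open>This is the precision available at \<open>x\<close>. It is at least
      \<open>2 * x + 1\<close> whenever \<open>x \<le> N [s]\<close> or
      \<open>x \<le> M [s, t]\<close>, so in both ranges \<open>\<psi>\<close> retains
      \<open>?\<phi>\<close>.\<close>
    let ?n = "\<lambda>x. if x \<le> N [s] then 2 * N [s] + 1 else 2 * M [s, t] + 1"
    have \<phi>: "approximates (?n x) (?\<phi> x) \<xi>" for x
      using ps0 ps by simp
    obtain \<psi> where \<psi>: "list_all2 names (unzip k (\<lambda>t. map (rounding t) (\<psi> t))) \<xi>"
        "\<And>x. approximates (2 * x + 1) (\<psi> x) \<xi>"
        "\<forall>x. 2 * x + 1 \<le> ?n x \<longrightarrow> \<psi> x = ?\<phi> x"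
      using ex_names_extending[of ?n ?\<phi>, OF \<phi> D[OF \<xi>]] by blast
    \<comment> \<open>Up to \<open>N [s]\<close> the sequence \<open>\<psi>\<close> equals
      \<open>ps0\<close>; hence the zero found from \<open>ps0\<close> is a zero of \<open>E\<close>
      at a genuine name.\<close>
    have "E (rounded_funs k (\<lambda>_. ps0)) ?z = E (rounded_funs k \<psi>) ?z"
      using \<psi>(3) by (intro E_const[OF D[OF \<xi>] s ps0 Z0 \<psi>(2)]) simp
    then have "E (rounded_funs k \<psi>) ?z = 0"
      using Z_zero[OF _ Z0] approximates_length[OF ps0] D[OF \<xi>] by simp
    then have "names (F (rounded_funs k \<psi> @ [\<lambda>x. ?z]), G (rounded_funs k \<psi> @ [\<lambda>x. ?z]), H (rounded_funs k \<psi> @ [\<lambda>x. ?z])) (\<theta> \<xi>)"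
      using nm[OF \<xi> \<psi>(1)] unfolding rounded_funs_def by blast
    moreover
    have len: "length (rounded_funs k \<chi> @ [\<lambda>_. ?z]) = 3 * k + 1" for \<chi>
      by simp
    \<comment> \<open>The extra constant argument is covered as well, because
      \<open>?z \<le> s\<close> and \<open>s\<close> lies below \<open>majorant s\<close>
      everywhere.\<close>
    have major: "\<forall>i<3 * k + 1. majorizes (majorant s) ((rounded_funs k \<chi> @ [\<lambda>_. ?z]) ! i)"
      if "\<And>x. approximates (n x) (\<chi> x) \<xi>" for n \<chi>
      using majorizes_rounded_funs[OF that s D[OF \<xi>]] Z0 order_trans[OF Z0 le_majorant]
      by (auto simp: nth_append less_Suc_eq majorizes_def)
    have "\<psi> x = ?\<phi> x" if "x \<le> M [s, t]" for x
      using \<psi>(3) that by simp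
    then have agree: "\<forall>i<3 * k + 1. \<forall>x\<le>m. (\<Phi> ps0 ps s ! i) x = ((rounded_funs k \<psi> @ [\<lambda>_. ?z]) ! i) x"
      if "m \<le> M [s, t]" for m
      using that by (auto simp: \<Phi>_def nth_append less_Suc_eq intro!: rounded_funs_cong)
    have "F (\<Phi> ps0 ps s) t = F (rounded_funs k \<psi> @ [\<lambda>_. ?z]) t"
      by (rule F_cong[unfolded modulus_def, rule_format, where s = s])
        (use len major[of ?n, OF \<phi>] major[of "\<lambda>x. 2 * x + 1", OF \<psi>(2)] agree[of "\<omega>\<^sub>F [s, t]"] in \<open>simp_all add: \<Phi>_def M_def\<close>)
    moreover have "G (\<Phi> ps0 ps s) t = G (rounded_funs k \<psi> @ [\<lambda>_. ?z]) t"
      by (rule G_cong[unfolded modulus_def, rule_format, where s = s])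
        (use len major[of ?n, OF \<phi>] major[of "\<lambda>x. 2 * x + 1", OF \<psi>(2)] agree[of "\<omega>\<^sub>G [s, t]"] in \<open>simp_all add: \<Phi>_def M_def\<close>)
    moreover have "H (\<Phi> ps0 ps s) t = H (rounded_funs k \<psi> @ [\<lambda>_. ?z]) t"
      by (rule H_cong[unfolded modulus_def, rule_format, where s = s])
        (use len major[of ?n, OF \<phi>] major[of "\<lambda>x. 2 * x + 1", OF \<psi>(2)] agree[of "\<omega>\<^sub>H [s, t]"] in \<open>simp_all add: \<Phi>_def M_def\<close>)
    ultimately show ?thesis
      by (simp del: triple_value.simps)
  qed

  have "definable 1 (\<lambda>v. 2 * N v + 1)"
    using N by (intro definable_add definable_mult definable_const) simp_all
  then obtain d0 where d0: "d0 \<in> \<F> 1" "\<And>s. d0 [s] = 2 * N [s] + 1"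
    by (rule mem_of_definable) simp
  have "definable 2 (\<lambda>v. 2 * M v + 1)"
    unfolding M_def using \<omega>\<^sub>F \<omega>\<^sub>G \<omega>\<^sub>H
    by (intro definable_add definable_mult definable_const definable_subst2 definable_nth) simp_all
  then obtain d where d: "d \<in> \<F> 2" "\<And>s t. d [s, t] = 2 * M [s, t] + 1"
    by (rule mem_of_definable) simp
  \<comment> \<open>Truncated subtraction makes \<open>e\<close> vanish exactly when the search
    succeeds.\<close>
  have "definable (Suc (3 * k)) (\<lambda>v. Z v - v ! (3 * k))"
    using Z by (intro definable_diff definable_nth) simp_all
  then obtain e where e: "e \<in> \<F> (3 * k + 1)" "\<And>ps s. length ps = k \<Longrightarrow> e (flat ps @ [s]) = Z (flat ps @ [s]) - s"
    by (rule mem_of_definable) (simp add: nth_append)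
  have "(\<exists>s0. \<forall>s\<ge>s0. \<forall>ps0. approximates (d0 [s]) ps0 \<xi> \<longrightarrow> e (flat ps0 @ [s]) = 0) \<and>
      (\<forall>s t ps0 ps. approximates (d0 [s]) ps0 \<xi> \<and> e (flat ps0 @ [s]) = 0 \<and>
        (\<forall>x\<in>set \<xi>. \<bar>x\<bar> \<le> real s + 1) \<and> approximates (d [s, t]) ps \<xi> \<longrightarrow>
        \<bar>triple_value (f (flat ps0 @ flat ps @ [s, t]), g (flat ps0 @ flat ps @ [s, t]),
          h (flat ps0 @ flat ps @ [s, t])) - \<theta> \<xi>\<bar> < 1 / (real t + 1))" if \<xi>: "\<xi> \<in> D" for \<xi>
  proof -
    have len: "length ps = k" if "approximates n ps \<xi>" for n ps
      using approximates_length[OF that] D[OF \<xi>] by simp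
    obtain s0 where "\<And>s ps0. s \<ge> s0 \<Longrightarrow> approximates (2 * N [s] + 1) ps0 \<xi> \<Longrightarrow> Z (flat ps0 @ [s]) \<le> s"
      using A[OF \<xi>] by blast
    then have "e (flat ps0 @ [s]) = 0" if "s \<ge> s0" "approximates (d0 [s]) ps0 \<xi>" for s ps0
      using that len[OF that(2)] by (simp add: d0(2) e(2))
    moreover have "\<bar>triple_value (f (flat ps0 @ flat ps @ [s, t]), g (flat ps0 @ flat ps @ [s, t]),
        h (flat ps0 @ flat ps @ [s, t])) - \<theta> \<xi>\<bar> < 1 / (real t + 1)"
      if "approximates (d0 [s]) ps0 \<xi>" "e (flat ps0 @ [s]) = 0" "\<forall>x\<in>set \<xi>. \<bar>x\<bar> \<le> real s + 1"
        "approximates (d [s, t]) ps \<xi>" for s t ps0 ps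
      using B[OF \<xi>, of s ps0 t ps] that len[OF that(1)] len[OF that(4)]
      by (simp add: d0(2) d(2) e(2) f(2) g(2) h(2) del: triple_value.simps)
    ultimately show ?thesis
      by blast
  qed
  from ballI[OF this] show ?thesis
    unfolding conditionally_computable_TZ_def Let_def
    by - (rule bexI[OF _ d0(1)], rule bexI[OF _ d(1)], rule bexI[OF _ e(1)], rule bexI[OF _ f(1)],
        rule bexI[OF _ g(1)], rule bexI[OF _ h(1)], assumption)
qed

end

theorem theorem5p2:
  fixes \<F> :: "nat \<Rightarrow> (nat list \<Rightarrow> nat) set"
    and \<O> :: "nat \<Rightarrow> op_on_funs set"
    and k :: nat
    and D :: "real list set"
    and \<theta> :: "real list \<Rightarrow> real"
  assumes "acceptable_pair \<F> \<O>"
    and "D \<subseteq> tuples k"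
  shows "conditionally_operator_computable \<O> k D \<theta> \<longleftrightarrow> conditionally_computable_TZ \<F> k D \<theta>"
  using acceptable_pair.TZ_of_operator_computable[OF assms(1) _ assms(2)]
    acceptable_pair.operator_computable_of_TZ[OF assms(1) _ assms(2)] by blast

end
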